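(* Let $\mathcal A=\{H_0,\dots,H_n\}$ be a central arrangement in $\mathbb C^{\ell+1}$, $0\le i<j\le n$, $1\le p\le\ell$, and let $\tau_{ij}:\mathcal F^p_{(i)}\to\mathcal F^p_{(j)}$ be as in the context. Let $[X_0<\cdots<X_p]\in\mathcal F^p$ with $H_i\not\le X_p$. (a) If $H_j\not\le X_p$, then $\tau_{ij}([X_0<\cdots<X_p])=[X_0<\cdots<X_p]$. (b) If $H_j\le X_p$ and $H_j\not\le X_{p-1}$, then \[ \tau_{ij}([X_0<\cdots<X_p])=-\sum_{\substack{X'\in L,\ \operatorname{codim}X'=p\\ X_{p-1}<X',\ X'\neq X_p}}[X_0<\cdots<X_{p-1}<X']. \]
   Context: $\mathcal A=\{H_0,\dots,H_n\}$ is a central arrangement of distinct hyperplanes in $\mathbb C^{\ell+1}$. $L$ is the set of intersections of subfamilies of $\mathcal A$ (including $\mathbb C^{\ell+1}$), partially ordered by reverse inclusion ($X\le Y$ iff $Y\subseteq X$; so $H\le X$ means $X\subseteq H$). A flag of length $p$ is a chain $(X_0<\cdots<X_p)$ in $L$ with $\operatorname{codim}X_r=r$. The flag space $\mathcal F=\bigoplus_p\mathcal F^p$ is the span of flags modulo all sums $\sum_Y(X_0<\cdots<X_{r-1}<Y<X_{r+1}<\cdots<X_p)$ over $Y\in L$ with $X_{r-1}<Y<X_{r+1}$, $\operatorname{codim}Y=r$; images written $[X_0<\cdots<X_p]$. The flag differential is $d[X_0<\cdots<X_p]=\sum_{X>X_p,\ \operatorname{codim}X=p+1}[X_0<\cdots<X_p<X]$,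 $\bar{\mathcal F}=\mathcal F/\operatorname{im}(d)$, $\pi:\mathcal F\to\bar{\mathcal F}$ the projection. For $X\in L$ of codimension $p$, $\mathcal F^p_X$ is the image in $\mathcal F^p$ of the span of flags ending at $X$. For each $k$ and $0\le p\le\ell$ put $\mathcal F^p_{(k)}=\bigoplus_{\operatorname{codim}X=p,\ H_k\not\le X}\mathcal F^p_X\subseteq\mathcal F^p$; the paper shows that $\pi$ restricts to an isomorphism $\mathcal F^p_{(k)}\to\bar{\mathcal F}^p$. Then $\tau_{ij}:\mathcal F^p_{(i)}\to\mathcal F^p_{(j)}$ sends $F$ to the unique element of $\mathcal F^p_{(j)}$ with the same image under $\pi$ as $F$ (this is the transition map between the dehomogenizations relative to $H_i$ and $H_j$). *)

theory Defs
  imports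
    "HOL-Analysis.Cartesian_Space"
    "HOL-Algebra.AbelCoset"
    "HOL-Algebra.Module"
begin

subsection \<open>Free modules, spans and quotient modules over \<open>\<complex>\<close>\<close>

definition CC :: "complex ring"
  where "CC = \<lparr>carrier = UNIV, monoid.mult = (*), one = 1, ring.zero = 0, add = (+)\<rparr>"

text \<open>Modules use the record type of \<^theory>\<open>HOL-Algebra.Module\<close>, whose ring multiplication and
  unit are irrelevant and left undefined.\<close>

definition free_module :: "'a set \<Rightarrow> (complex, 'a \<Rightarrow> complex) module"
  where "free_module B =
    \<lparr>carrier = {f. finite {x. f x \<noteq> 0} \<and> {x. f x \<noteq> 0} \<subseteq> B},
     monoid.mult = undefined, one = undefined,
     ring.zero = (\<lambda>x. 0), add = (\<lambda>f g x. f x + g x),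
     module.smult = (\<lambda>c f x. c * f x)\<rparr>"

definition basis_elt :: "'a \<Rightarrow> 'a \<Rightarrow> complex"
  where "basis_elt b = (\<lambda>x. if x = b then 1 else 0)"

definition span_of :: "(complex, 'a) module \<Rightarrow> 'a set \<Rightarrow> 'a set"
  where "span_of M S = \<Inter>{N. submodule N CC M \<and> S \<subseteq> N}"

text \<open>The scalar multiplication takes a union over representatives; for a submodule \<open>N\<close> all of them
  give the same coset.\<close>

definition quot_module :: "(complex, 'a) module \<Rightarrow> 'a set \<Rightarrow> (complex, 'a set) module"
  where "quot_module M N =
    \<lparr>carrier = a_rcosets\<^bsub>M\<^esub> N,
     monoid.mult = undefined, one = undefined,
     ring.zero = N, add = set_add M,
     module.smult = (\<lambda>c A. \<Union>a\<in>A. N +>\<^bsub>M\<^esub> (c \<odot>\<^bsub>M\<^esub> a))\<rparr>"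

lemma cring_CC: "cring CC"
proof (rule cringI)
  show "abelian_group CC"
  proof (rule abelian_groupI)
    fix x assume "x \<in> carrier CC"
    have "- x \<oplus>\<^bsub>CC\<^esub> x = \<zero>\<^bsub>CC\<^esub>" by (simp add: CC_def)
    moreover have "- x \<in> carrier CC" by (simp add: CC_def)
    ultimately show "\<exists>y\<in>carrier CC. y \<oplus>\<^bsub>CC\<^esub> x = \<zero>\<^bsub>CC\<^esub>" by blast
  qed (auto simp: CC_def)
  show "Group.comm_monoid CC"
    by (rule comm_monoidI) (auto simp: CC_def)
qed (auto simp: CC_def algebra_simps)

lemma module_free_module: "Module.module CC (free_module B)"
proof (rule Module.moduleI)
  show "cring CC" by (rule cring_CC)
  have add: "f \<oplus>\<^bsub>free_module B\<^esub> g \<in> carrier (free_module B)"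
    if "f \<in> carrier (free_module B)" "g \<in> carrier (free_module B)" for f g
  proof -
    have "{x. f x + g x \<noteq> 0} \<subseteq> {x. f x \<noteq> 0} \<union> {x. g x \<noteq> 0}" by auto
    then show ?thesis
      using that by (auto simp: free_module_def intro: finite_subset)
  qed
  show "abelian_group (free_module B)"
  proof (rule abelian_groupI)
    fix f assume "f \<in> carrier (free_module B)"
    then have "(\<lambda>x. - f x) \<in> carrier (free_module B)"
      and "(\<lambda>x. - f x) \<oplus>\<^bsub>free_module B\<^esub> f = \<zero>\<^bsub>free_module B\<^esub>"
      by (auto simp: free_module_def)
    then show "\<exists>g\<in>carrier (free_module B). g \<oplus>\<^bsub>free_module B\<^esub> f = \<zero>\<^bsub>free_module B\<^esub>"
      by blast
  qed (use add in \<open>simp_all add: free_module_def algebra_simps\<close>)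
  show "c \<odot>\<^bsub>free_module B\<^esub> f \<in> carrier (free_module B)"
    if "f \<in> carrier (free_module B)" for c f
    using that by (cases "c = 0") (auto simp: free_module_def)
qed (simp_all add: free_module_def CC_def algebra_simps)

lemma submodule_span_of:
  assumes "Module.module CC M" "S \<subseteq> carrier M"
  shows "submodule (span_of M S) CC M"
proof -
  interpret Module.module CC M by fact
  show ?thesis
  proof (rule submoduleI)
    show "span_of M S \<subseteq> carrier M"
      unfolding span_of_def using carrier_is_submodule assms(2) by blast
    show "\<zero>\<^bsub>M\<^esub> \<in> span_of M S"
      unfolding span_of_def
      using subgroup.one_closed[OF submodule.axioms(1)] by fastforce
  qed (auto simp: span_of_def dest: submoduleE(3-5))
qed

lemma module_quot_module:
  assumes "Module.module CC M" "submodule N CC M"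
  shows "Module.module CC (quot_module M N)"
proof -
  interpret Module.module CC M by fact
  interpret N: submodule N CC M by fact
  interpret abelian_subgroup N M
    by (rule abelian_subgroupI3)
      (auto intro: additive_subgroup.intro N.subgroup_axioms M.abelian_group_axioms)
  let ?Q = "quot_module M N"
  have carr: "carrier ?Q = (\<lambda>a. N +>\<^bsub>M\<^esub> a) ` carrier M"
    by (auto simp: quot_module_def A_RCOSETS_def')
  have add: "(N +>\<^bsub>M\<^esub> a) \<oplus>\<^bsub>?Q\<^esub> (N +>\<^bsub>M\<^esub> b) = N +>\<^bsub>M\<^esub> (a \<oplus>\<^bsub>M\<^esub> b)"
    if "a \<in> carrier M" "b \<in> carrier M" for a b
    using that by (simp add: quot_module_def a_rcos_sum)
  have zero: "\<zero>\<^bsub>?Q\<^esub> = N +>\<^bsub>M\<^esub> \<zero>\<^bsub>M\<^esub>"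
    by (simp add: quot_module_def a_coset_add_zero a_subset)
  have M_smult: "c \<odot>\<^bsub>M\<^esub> a \<in> carrier M" if "c \<in> carrier CC" "a \<in> carrier M" for c a
    using that by (rule smult_closed)
  have smult: "c \<odot>\<^bsub>?Q\<^esub> (N +>\<^bsub>M\<^esub> a) = N +>\<^bsub>M\<^esub> (c \<odot>\<^bsub>M\<^esub> a)"
    if a: "a \<in> carrier M" and c: "c \<in> carrier CC" for a c
  proof -
    have "N +>\<^bsub>M\<^esub> (c \<odot>\<^bsub>M\<^esub> b) = N +>\<^bsub>M\<^esub> (c \<odot>\<^bsub>M\<^esub> a)" if b: "b \<in> N +>\<^bsub>M\<^esub> a" for b
    proof -
      obtain h where h: "h \<in> N" "b = h \<oplus>\<^bsub>M\<^esub> a"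
        using b by (auto simp: a_r_coset_def')
      then have "c \<odot>\<^bsub>M\<^esub> b = c \<odot>\<^bsub>M\<^esub> h \<oplus>\<^bsub>M\<^esub> c \<odot>\<^bsub>M\<^esub> a"
        using a c a_subset by (auto intro: smult_r_distr)
      moreover have "c \<odot>\<^bsub>M\<^esub> h \<in> N" using h c by auto
      ultimately have "c \<odot>\<^bsub>M\<^esub> b \<in> N +>\<^bsub>M\<^esub> (c \<odot>\<^bsub>M\<^esub> a)"
        by (auto simp: a_r_coset_def')
      then show ?thesis
        using a_repr_independence[OF _ _ a_subgroup] M_smult[OF c a] by blast
    qed
    moreover have "a \<in> N +>\<^bsub>M\<^esub> a" using a by (rule a_rcos_self)
    ultimately have "(\<Union>b\<in>N +>\<^bsub>M\<^esub> a. N +>\<^bsub>M\<^esub> (c \<odot>\<^bsub>M\<^esub> b)) = N +>\<^bsub>M\<^esub> (c \<odot>\<^bsub>M\<^esub> a)"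
      by blast
    then show ?thesis by (simp add: quot_module_def)
  qed
  show ?thesis
  proof (rule Module.moduleI)
    show "cring CC" by (rule cring_CC)
    show "abelian_group ?Q"
    proof (rule abelian_groupI)
      fix x assume "x \<in> carrier ?Q"
      then obtain a where a: "a \<in> carrier M" "x = N +>\<^bsub>M\<^esub> a" by (auto simp: carr)
      then have "(N +>\<^bsub>M\<^esub> (\<ominus>\<^bsub>M\<^esub> a)) \<oplus>\<^bsub>?Q\<^esub> x = \<zero>\<^bsub>?Q\<^esub>"
        by (simp add: add zero M.l_neg)
      then show "\<exists>y\<in>carrier ?Q. y \<oplus>\<^bsub>?Q\<^esub> x = \<zero>\<^bsub>?Q\<^esub>"
        using a by (auto simp: carr)
    qed (auto simp: carr add zero M.a_ac)
  qed (auto simp: carr add smult smult_l_distr smult_r_distr smult_assoc1)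
qed


subsection \<open>Arrangements and flags\<close>

definition linear_hyperplane :: "(complex ^ 'm) set \<Rightarrow> bool"
  where "linear_hyperplane V \<longleftrightarrow> vec.subspace V \<and> vec.dim V + 1 = CARD('m)"

definition central_arrangement :: "(nat \<Rightarrow> (complex ^ 'm) set) \<Rightarrow> nat \<Rightarrow> bool"
  where "central_arrangement H n \<longleftrightarrow>
    (\<forall>k\<le>n. linear_hyperplane (H k)) \<and> inj_on H {..n}"

definition codim :: "(complex ^ 'm) set \<Rightarrow> nat"
  where "codim X = CARD('m) - vec.dim X"

text \<open>The empty subfamily contributes the whole space.\<close>

definition lat :: "(nat \<Rightarrow> (complex ^ 'm) set) \<Rightarrow> nat \<Rightarrow> (complex ^ 'm) set set"
  where "lat H n = {\<Inter>k\<in>S. H k | S. S \<subseteq> {..n}}"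

text \<open>The order of the lattice is reverse inclusion.\<close>

definition lat_le :: "'a set \<Rightarrow> 'a set \<Rightarrow> bool" (infix \<open>\<preceq>\<close> 50)
  where "X \<preceq> Y \<longleftrightarrow> Y \<subseteq> X"

definition lat_less :: "'a set \<Rightarrow> 'a set \<Rightarrow> bool" (infix \<open>\<prec>\<close> 50)
  where "X \<prec> Y \<longleftrightarrow> X \<preceq> Y \<and> X \<noteq> Y"

definition is_flag ::
    "(nat \<Rightarrow> (complex ^ 'm) set) \<Rightarrow> nat \<Rightarrow> nat \<Rightarrow> (complex ^ 'm) set list \<Rightarrow> bool"
  where "is_flag H n p Xs \<longleftrightarrow>
    length Xs = p + 1 \<and> set Xs \<subseteq> lat H n \<and> sorted_wrt (\<prec>) Xs \<and> (\<forall>r\<le>p. codim (Xs ! r) = r)"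

definition flags :: "(nat \<Rightarrow> (complex ^ 'm) set) \<Rightarrow> nat \<Rightarrow> (complex ^ 'm) set list set"
  where "flags H n = {Xs. \<exists>p. is_flag H n p Xs}"


subsection \<open>The flag space\<close>

abbreviation flag_chains ::
    "(nat \<Rightarrow> (complex ^ 'm) set) \<Rightarrow> nat \<Rightarrow> (complex, (complex ^ 'm) set list \<Rightarrow> complex) module"
  where "flag_chains H n \<equiv> free_module (flags H n)"

text \<open>Between two elements of the lattice whose codimensions differ by 2 there is always an element
  of intermediate codimension, so every chain with one gap arises from some flag \<open>Xs\<close> by
  disregarding its entry at the position \<open>r\<close>.\<close>

definition flag_relations ::
    "(nat \<Rightarrow> (complex ^ 'm) set) \<Rightarrow> nat \<Rightarrow> ((complex ^ 'm) set list \<Rightarrow> complex) set"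
  where "flag_relations H n =
    {\<Oplus>\<^bsub>flag_chains H n\<^esub> Y \<in> {Y \<in> lat H n. Xs ! (r - 1) \<prec> Y \<and> Y \<prec> Xs ! (r + 1) \<and> codim Y = r}.
       basis_elt (Xs[r := Y])
     | Xs p r. is_flag H n p Xs \<and> 0 < r \<and> r < p}"

definition flag_rel_span ::
    "(nat \<Rightarrow> (complex ^ 'm) set) \<Rightarrow> nat \<Rightarrow> ((complex ^ 'm) set list \<Rightarrow> complex) set"
  where "flag_rel_span H n = span_of (flag_chains H n) (flag_relations H n)"

definition flag_space ::
    "(nat \<Rightarrow> (complex ^ 'm) set) \<Rightarrow> nat \<Rightarrow> (complex, ((complex ^ 'm) set list \<Rightarrow> complex) set) module"
  where "flag_space H n = quot_module (flag_chains H n) (flag_rel_span H n)"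

definition flag_proj ::
    "(nat \<Rightarrow> (complex ^ 'm) set) \<Rightarrow> nat \<Rightarrow> ((complex ^ 'm) set list \<Rightarrow> complex)
      \<Rightarrow> ((complex ^ 'm) set list \<Rightarrow> complex) set"
  where "flag_proj H n c = flag_rel_span H n +>\<^bsub>flag_chains H n\<^esub> c"

definition flag_class ::
    "(nat \<Rightarrow> (complex ^ 'm) set) \<Rightarrow> nat \<Rightarrow> (complex ^ 'm) set list
      \<Rightarrow> ((complex ^ 'm) set list \<Rightarrow> complex) set"
  where "flag_class H n Xs = flag_proj H n (basis_elt Xs)"

text \<open>The linear extension of the formula for the differential to combinations of flags is constant
  on the cosets of the relations; its value on a coset is the differential.\<close>

definition pre_diff ::
    "(nat \<Rightarrow> (complex ^ 'm) set) \<Rightarrow> nat \<Rightarrow> ((complex ^ 'm) set list \<Rightarrow> complex)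
      \<Rightarrow> ((complex ^ 'm) set list \<Rightarrow> complex) set"
  where "pre_diff H n c =
    (\<Oplus>\<^bsub>flag_space H n\<^esub> Xs \<in> flags H n. c Xs \<odot>\<^bsub>flag_space H n\<^esub>
      (\<Oplus>\<^bsub>flag_space H n\<^esub> X \<in> {X \<in> lat H n. last Xs \<prec> X \<and> codim X = codim (last Xs) + 1}.
        flag_class H n (Xs @ [X])))"

definition flag_diff ::
    "(nat \<Rightarrow> (complex ^ 'm) set) \<Rightarrow> nat \<Rightarrow> ((complex ^ 'm) set list \<Rightarrow> complex) set
      \<Rightarrow> ((complex ^ 'm) set list \<Rightarrow> complex) set"
  where "flag_diff H n A = the_elem (pre_diff H n ` A)"

definition im_diff ::
    "(nat \<Rightarrow> (complex ^ 'm) set) \<Rightarrow> nat \<Rightarrow> ((complex ^ 'm) set list \<Rightarrow> complex) set set"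
  where "im_diff H n = flag_diff H n ` carrier (flag_space H n)"

definition reduced_flag_space ::
    "(nat \<Rightarrow> (complex ^ 'm) set) \<Rightarrow> nat
      \<Rightarrow> (complex, ((complex ^ 'm) set list \<Rightarrow> complex) set set) module"
  where "reduced_flag_space H n = quot_module (flag_space H n) (im_diff H n)"

definition red_proj ::
    "(nat \<Rightarrow> (complex ^ 'm) set) \<Rightarrow> nat \<Rightarrow> ((complex ^ 'm) set list \<Rightarrow> complex) set
      \<Rightarrow> ((complex ^ 'm) set list \<Rightarrow> complex) set set"
  where "red_proj H n F = im_diff H n +>\<^bsub>flag_space H n\<^esub> F"


subsection \<open>Dehomogenization and transition maps\<close>

definition flag_comp ::
    "(nat \<Rightarrow> (complex ^ 'm) set) \<Rightarrow> nat \<Rightarrow> nat \<Rightarrow> (complex ^ 'm) set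
      \<Rightarrow> ((complex ^ 'm) set list \<Rightarrow> complex) set set"
  where "flag_comp H n p X =
    flag_proj H n ` span_of (flag_chains H n) {basis_elt Xs | Xs. is_flag H n p Xs \<and> last Xs = X}"

text \<open>The internal sum of the components; it is direct because the relations never change the last
  entry of a flag.\<close>

definition dehom_space ::
    "(nat \<Rightarrow> (complex ^ 'm) set) \<Rightarrow> nat \<Rightarrow> nat \<Rightarrow> nat
      \<Rightarrow> ((complex ^ 'm) set list \<Rightarrow> complex) set set"
  where "dehom_space H n p k =
    (let S = {X \<in> lat H n. codim X = p \<and> \<not> H k \<preceq> X}
     in {\<Oplus>\<^bsub>flag_space H n\<^esub> X \<in> S. g X | g. g \<in> (\<Pi> X\<in>S. flag_comp H n p X)})"

definition transition ::
    "(nat \<Rightarrow> (complex ^ 'm) set) \<Rightarrow> nat \<Rightarrow> nat \<Rightarrow> nat \<Rightarrow> nat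
      \<Rightarrow> ((complex ^ 'm) set list \<Rightarrow> complex) set \<Rightarrow> ((complex ^ 'm) set list \<Rightarrow> complex) set"
  where "transition H n p i j =
    (\<lambda>F \<in> dehom_space H n p i.
      THE G. G \<in> dehom_space H n p j \<and> red_proj H n G = red_proj H n F)"

end

theory Submission
  imports Defs "HOL-Library.Function_Algebras"
begin

text \<open>
  Both parts exhibit an element of the target space that is congruent to the given flag modulo the
  image of the differential \<open>d\<close>: the flag itself in (a), and its difference with
  \<open>d[X\<^sub>0 < \<dots> < X\<^bsub>p-1\<^esub>]\<close> in (b), where \<open>X\<^sub>p = X\<^bsub>p-1\<^esub> \<inter> H\<^sub>j\<close> is the only
  element of codimension \<open>p\<close> above \<open>X\<^bsub>p-1\<^esub>\<close> and \<open>H\<^sub>j\<close>. What remains is the injectivity of the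
  projection \<open>\<pi>\<close> on \<open>F\<^sub>(\<^sub>j\<^sub>)\<close>. There is a linear map \<open>h\<close> of degree \<open>-1\<close> on the flag space with
  \<open>h d G = G\<close> for \<open>G\<close> in \<open>F\<^sub>(\<^sub>j\<^sub>)\<close>, so if moreover \<open>G = d F\<close>, then \<open>G = h d d F = 0\<close>.
  On a flag whose last entry is its only one contained in \<open>H\<^sub>j\<close>, the map \<open>h\<close> drops that entry, and
  it vanishes on flags with no entry in \<open>H\<^sub>j\<close>; the relations force its values on all other flags.

  Everything is done dually: a functional on flags is admissible if it kills the relations, the
  relation span is the common kernel of the admissible functionals, and the transposes of \<open>d\<close>
  and \<open>h\<close> act on admissible functionals.
\<close>

subsection \<open>Submodules and quotients of free modules\<close>

lemma sum_fun_apply: "(\<Sum>k\<in>K. f k) x = (\<Sum>k\<in>K. f k x)"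
  by (induction K rule: infinite_finite_induct) auto

lemma free_module_simps [simp]:
  "a \<oplus>\<^bsub>free_module B\<^esub> b = a + b"
  "\<zero>\<^bsub>free_module B\<^esub> = 0"
  "c \<odot>\<^bsub>free_module B\<^esub> a = (\<lambda>x. c * a x)"
  by (auto simp: free_module_def plus_fun_def zero_fun_def)

lemma carrier_free_module:
  "finite B \<Longrightarrow> carrier (free_module B) = {c. \<forall>x. x \<notin> B \<longrightarrow> c x = 0}"
  by (auto simp: free_module_def intro: finite_subset)

lemma carrier_free_module_mono: "A \<subseteq> B \<Longrightarrow> carrier (free_module A) \<subseteq> carrier (free_module B)"
  by (auto simp: free_module_def)

lemma carrier_CC [simp]: "carrier CC = UNIV"
  by (simp add: CC_def)

lemma uminus_free_module:
  assumes "a \<in> carrier (free_module B)"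
  shows "\<ominus>\<^bsub>free_module B\<^esub> a = - a"
proof -
  interpret Module.module CC "free_module B" by (rule module_free_module)
  have "- a \<in> carrier (free_module B)" using assms by (auto simp: free_module_def)
  then show ?thesis using assms by (intro minus_equality) auto
qed

lemma finsum_free_module:
  assumes "finite K" "\<And>k. k \<in> K \<Longrightarrow> f k \<in> carrier (free_module B)"
  shows "(\<Oplus>\<^bsub>free_module B\<^esub> k\<in>K. f k) = (\<Sum>k\<in>K. f k)"
proof -
  interpret Module.module CC "free_module B" by (rule module_free_module)
  show ?thesis using assms by (induction K) (auto simp: finsum_insert Pi_def)
qed

lemma sum_basis_elt:
  assumes "finite B" "c \<in> carrier (free_module B)"
  shows "c = (\<Sum>b\<in>B. (\<lambda>x. c b * basis_elt b x))"
proof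
  fix x
  have "(\<Sum>b\<in>B. c b * basis_elt b x) = (\<Sum>b\<in>B. if x = b then c b else 0)"
    by (intro sum.cong) (auto simp: basis_elt_def)
  then show "c x = (\<Sum>b\<in>B. (\<lambda>x. c b * basis_elt b x)) x"
    using assms by (auto simp: sum_fun_apply carrier_free_module)
qed

lemma submodule_sum:
  assumes N: "submodule N CC (free_module B)" and f: "\<And>k. k \<in> K \<Longrightarrow> f k \<in> N"
  shows "(\<Sum>k\<in>K. f k) \<in> N"
proof -
  interpret Module.module CC "free_module B" by (rule module_free_module)
  interpret N: submodule N CC "free_module B" by (rule N)
  show ?thesis
    using f N.one_closed N.m_closed
    by (induction K rule: infinite_finite_induct) auto
qed

lemma submodule_smult:
  assumes N: "submodule N CC (free_module B)" and a: "a \<in> N"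
  shows "(\<lambda>x. c * a x) \<in> N"
  using submodule.smult_closed[OF N _ a, of c] by simp

lemma submodule_add:
  assumes N: "submodule N CC (free_module B)" and a: "a \<in> N" "b \<in> N"
  shows "a + b \<in> N"
  using subgroup.m_closed[OF submodule.axioms(1)[OF N] a] by simp

lemma submodule_free_moduleI:
  assumes "N \<subseteq> carrier (free_module B)" "0 \<in> N" "\<And>a b. a \<in> N \<Longrightarrow> b \<in> N \<Longrightarrow> a + b \<in> N"
    "\<And>c a. a \<in> N \<Longrightarrow> (\<lambda>x. c * a x) \<in> N"
  shows "submodule N CC (free_module B)"
proof -
  interpret Module.module CC "free_module B" by (rule module_free_module)
  show ?thesis
  proof (rule submoduleI)
    fix a assume "a \<in> N"
    then show "\<ominus>\<^bsub>free_module B\<^esub> a \<in> N"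
      using assms(1) assms(4)[of a "-1"] by (auto simp: uminus_free_module fun_Compl_def)
  qed (use assms in auto)
qed

text \<open>Identifies the spans in \<open>flag_comp\<close> with functions supported on a set of
  flags: each of them is the finite combination of basis elements whose coefficients are its own
  values.\<close>

lemma span_of_basis_elts:
  assumes "finite B" "A \<subseteq> B"
  shows "span_of (free_module B) (basis_elt ` A) = carrier (free_module A)"
proof
  have fA: "finite A" using assms finite_subset by blast
  have "submodule (carrier (free_module A)) CC (free_module B)"
    using assms fA by (intro submodule_free_moduleI) (auto simp: carrier_free_module)
  moreover have "basis_elt ` A \<subseteq> carrier (free_module A)"
    using fA by (auto simp: carrier_free_module basis_elt_def)
  ultimately show "span_of (free_module B) (basis_elt ` A) \<subseteq> carrier (free_module A)"
    unfolding span_of_def by blast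
  show "carrier (free_module A) \<subseteq> span_of (free_module B) (basis_elt ` A)"
  proof
    fix c assume c: "c \<in> carrier (free_module A)"
    have sub: "submodule (span_of (free_module B) (basis_elt ` A)) CC (free_module B)"
      using assms by (intro submodule_span_of module_free_module)
        (auto simp: carrier_free_module basis_elt_def)
    have "(\<Sum>b\<in>A. (\<lambda>x. c b * basis_elt b x)) \<in> span_of (free_module B) (basis_elt ` A)"
      by (intro submodule_sum[OF sub] submodule_smult[OF sub]) (auto simp: span_of_def)
    then show "c \<in> span_of (free_module B) (basis_elt ` A)"
      using sum_basis_elt[OF fA c] by simp
  qed
qed

text \<open>Lying outside \<open>N\<close>, the element \<open>c\<close> is independent of a basis
  of \<open>N\<close>, so some linear functional is 0 on \<open>N\<close> and 1 at \<open>c\<close>.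
  As \<open>B\<close> is finite, its values on the basis elements determine it on the carrier and
  serve as \<open>\<phi>\<close>.\<close>

lemma separating_functional:
  assumes N: "submodule N CC (free_module B)" and B: "finite B"
    and c: "c \<in> carrier (free_module B)" "c \<notin> N"
  obtains \<phi> where "\<And>a. a \<in> N \<Longrightarrow> (\<Sum>x\<in>B. a x * \<phi> x) = 0" "(\<Sum>x\<in>B. c x * \<phi> x) = 1"
proof -
  interpret V: vector_space "\<lambda>(k::complex) (f :: 'a \<Rightarrow> complex) x. k * f x"
    by unfold_locales (simp_all add: fun_eq_iff distrib_left distrib_right)
  interpret P: vector_space_pair "\<lambda>(k::complex) (f :: 'a \<Rightarrow> complex) x. k * f x" "(*) :: complex \<Rightarrow> _"
    by unfold_locales
  interpret NN: submodule N CC "free_module B" by (rule N)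
  have NB: "N \<subseteq> carrier (free_module B)" using NN.subset by simp
  have subN: "V.subspace N"
    using NN.one_closed submodule_add[OF N] submodule_smult[OF N] by (auto simp: V.subspace_def)
  obtain S where S: "S \<subseteq> N" "V.independent S" "N \<subseteq> V.span S"
    by (rule V.maximal_independent_subset)
  have span: "V.span S = N" using V.span_minimal[OF S(1) subN] S(3) by (rule subset_antisym)
  then have "V.independent (insert c S)" using S(2) c(2) by (intro V.independent_insertI) simp_all
  then obtain f where f: "Vector_Spaces.linear (\<lambda>(k::complex) (f :: 'a \<Rightarrow> complex) x. k * f x) (*) f"
    and fS: "\<And>s. s \<in> insert c S \<Longrightarrow> f s = (if s = c then 1 else 0)"
    using P.linear_independent_extend[of "insert c S" "\<lambda>s. if s = c then 1 else 0"] by metis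
  interpret f: Vector_Spaces.linear "\<lambda>(k::complex) (f :: 'a \<Rightarrow> complex) x. k * f x" "(*)" f by (rule f)
  have eval: "(\<Sum>x\<in>B. a x * f (basis_elt x)) = f a" if "a \<in> carrier (free_module B)" for a
  proof -
    have "f a = f (\<Sum>b\<in>B. (\<lambda>x. a b * basis_elt b x))" using sum_basis_elt[OF B that] by simp
    also have "\<dots> = (\<Sum>b\<in>B. a b * f (basis_elt b))" by (simp add: f.sum f.scale)
    finally show ?thesis by simp
  qed
  have "f a = 0" if "a \<in> N" for a
  proof (rule f.eq_0_on_span[of S])
    show "f s = 0" if "s \<in> S" for s using fS[of s] that S c by auto
  qed (use that span in simp)
  then have "(\<Sum>x\<in>B. a x * f (basis_elt x)) = 0" if "a \<in> N" for a
    using eval[of a] NB that by auto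
  moreover have "(\<Sum>x\<in>B. c x * f (basis_elt x)) = 1" using eval[OF c(1)] fS[of c] by simp
  ultimately show ?thesis by (rule that)
qed

section \<open>Computing with representatives in a quotient module\<close>

locale submodule_quotient =
  fixes M :: "(complex, 'a) module" and N :: "'a set"
  assumes module: "Module.module CC M" and submodule: "submodule N CC M"
begin

sublocale M: Module.module CC M by (rule module)

sublocale N: submodule N CC M by (rule submodule)

sublocale N: abelian_subgroup N M
  by (rule abelian_subgroupI3)
    (auto intro: additive_subgroup.intro N.subgroup_axioms M.abelian_group_axioms)

sublocale Q: Module.module CC "quot_module M N"
  by (rule module_quot_module[OF module submodule])

lemma carrier_quot_module: "carrier (quot_module M N) = (\<lambda>a. N +>\<^bsub>M\<^esub> a) ` carrier M"
  by (auto simp: quot_module_def A_RCOSETS_def')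

lemma add_coset:
  assumes "a \<in> carrier M" "b \<in> carrier M"
  shows "(N +>\<^bsub>M\<^esub> a) \<oplus>\<^bsub>quot_module M N\<^esub> (N +>\<^bsub>M\<^esub> b) = N +>\<^bsub>M\<^esub> (a \<oplus>\<^bsub>M\<^esub> b)"
  using assms by (simp add: quot_module_def N.a_rcos_sum)

lemma zero_coset: "\<zero>\<^bsub>quot_module M N\<^esub> = N +>\<^bsub>M\<^esub> \<zero>\<^bsub>M\<^esub>"
  by (simp add: quot_module_def M.a_coset_add_zero N.a_subset)

lemma coset_eq_iff:
  assumes "a \<in> carrier M" "b \<in> carrier M"
  shows "N +>\<^bsub>M\<^esub> a = N +>\<^bsub>M\<^esub> b \<longleftrightarrow> a \<oplus>\<^bsub>M\<^esub> \<ominus>\<^bsub>M\<^esub> b \<in> N"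
  using N.a_rcos_module[of b a] N.a_rcos_self[of a] M.a_repr_independence[of a N b] N.a_subgroup assms
  by auto

lemma uminus_coset:
  assumes "a \<in> carrier M"
  shows "\<ominus>\<^bsub>quot_module M N\<^esub> (N +>\<^bsub>M\<^esub> a) = N +>\<^bsub>M\<^esub> (\<ominus>\<^bsub>M\<^esub> a)"
  using assms
  by (intro Q.minus_equality) (auto simp: carrier_quot_module add_coset zero_coset M.l_neg)

lemma smult_coset:
  assumes a: "a \<in> carrier M"
  shows "c \<odot>\<^bsub>quot_module M N\<^esub> (N +>\<^bsub>M\<^esub> a) = N +>\<^bsub>M\<^esub> (c \<odot>\<^bsub>M\<^esub> a)"
proof -
  have "N +>\<^bsub>M\<^esub> (c \<odot>\<^bsub>M\<^esub> b) = N +>\<^bsub>M\<^esub> (c \<odot>\<^bsub>M\<^esub> a)" if b: "b \<in> N +>\<^bsub>M\<^esub> a" for b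
  proof -
    obtain h where h: "h \<in> N" "b = h \<oplus>\<^bsub>M\<^esub> a" using b by (auto simp: a_r_coset_def')
    then have "h \<in> carrier M" by auto
    then have "c \<odot>\<^bsub>M\<^esub> b = c \<odot>\<^bsub>M\<^esub> h \<oplus>\<^bsub>M\<^esub> c \<odot>\<^bsub>M\<^esub> a"
      using a h by (auto intro: M.smult_r_distr)
    moreover have "c \<odot>\<^bsub>M\<^esub> h \<in> N" using h by auto
    ultimately have "c \<odot>\<^bsub>M\<^esub> b \<in> N +>\<^bsub>M\<^esub> (c \<odot>\<^bsub>M\<^esub> a)" by (auto simp: a_r_coset_def')
    moreover have "c \<odot>\<^bsub>M\<^esub> a \<in> carrier M" using a by (intro M.smult_closed) auto
    ultimately show ?thesis using M.a_repr_independence[OF _ _ N.a_subgroup] by blast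
  qed
  moreover have "a \<in> N +>\<^bsub>M\<^esub> a" using a by (rule N.a_rcos_self)
  ultimately have "(\<Union>b\<in>N +>\<^bsub>M\<^esub> a. N +>\<^bsub>M\<^esub> (c \<odot>\<^bsub>M\<^esub> b)) = N +>\<^bsub>M\<^esub> (c \<odot>\<^bsub>M\<^esub> a)"
    by blast
  then show ?thesis by (simp add: quot_module_def)
qed

lemma finsum_coset:
  assumes "finite K" "\<And>k. k \<in> K \<Longrightarrow> f k \<in> carrier M"
  shows "(\<Oplus>\<^bsub>quot_module M N\<^esub> k\<in>K. N +>\<^bsub>M\<^esub> f k) = N +>\<^bsub>M\<^esub> (\<Oplus>\<^bsub>M\<^esub> k\<in>K. f k)"
  using assms
proof (induction K)
  case empty
  then show ?case by (simp add: zero_coset)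
next
  case (insert k K)
  have "(\<lambda>k. N +>\<^bsub>M\<^esub> f k) \<in> K \<rightarrow> carrier (quot_module M N)"
    using insert.prems by (auto simp: carrier_quot_module)
  moreover have "N +>\<^bsub>M\<^esub> f k \<in> carrier (quot_module M N)"
    using insert.prems by (auto simp: carrier_quot_module)
  moreover have "f \<in> K \<rightarrow> carrier M" "f k \<in> carrier M" using insert.prems by auto
  ultimately show ?case
    using insert by (simp add: M.finsum_insert Q.finsum_insert add_coset)
qed

end

subsection \<open>Functionals on flags\<close>

locale arrangement =
  fixes H :: "nat \<Rightarrow> (complex ^ 'm) set" and n :: nat
  assumes arrangement: "central_arrangement H n"
begin

section \<open>Covers in the intersection lattice\<close>

text \<open>The lattice is graded by codimension: the jump by 1 makes the inclusion strict and
  excludes intermediate elements.\<close>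

definition covers :: "(complex ^ 'm) set \<Rightarrow> (complex ^ 'm) set \<Rightarrow> bool"
  where "covers X Y \<longleftrightarrow> X \<in> lat H n \<and> Y \<in> lat H n \<and> Y \<subseteq> X \<and> codim Y = codim X + 1"

lemma finite_lat: "finite (lat H n)"
proof -
  have "lat H n = (\<lambda>S. \<Inter>k\<in>S. H k) ` Pow {..n}"
    by (auto simp: lat_def)
  then show ?thesis by simp
qed

lemma lat_subspace: "X \<in> lat H n \<Longrightarrow> vec.subspace X"
  using arrangement
  by (auto simp: lat_def central_arrangement_def linear_hyperplane_def intro!: vec.subspace_Inter)

lemma lat_Int_hyperplane:
  assumes "X \<in> lat H n" "k \<le> n"
  shows "X \<inter> H k \<in> lat H n"
proof -
  obtain S where "S \<subseteq> {..n}" "X = (\<Inter>k\<in>S. H k)" using assms by (auto simp: lat_def)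
  then have "X \<inter> H k = (\<Inter>k\<in>insert k S. H k)" "insert k S \<subseteq> {..n}" using assms by auto
  then show ?thesis unfolding lat_def by blast
qed

lemma codim_add_dim: "codim X + vec.dim X = CARD('m)" for X :: "(complex ^ 'm) set"
  using dim_subset_UNIV_cart_gen[of X] by (simp add: codim_def)

lemma lat_eqI:
  assumes "X \<in> lat H n" "Y \<in> lat H n" "X \<subseteq> Y" "codim X = codim Y"
  shows "X = Y"
  using codim_add_dim[of X] codim_add_dim[of Y] assms
  by (intro vec.subspace_dim_equal) (auto simp: lat_subspace)

text \<open>The dimension formula for \<open>X + H k\<close> bounds the drop in dimension by one,
  and without a drop the intersection would be all of \<open>X\<close>.\<close>

lemma covers_Int_hyperplane:
  assumes X: "X \<in> lat H n" and k: "k \<le> n" and "\<not> X \<subseteq> H k"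
  shows "covers X (X \<inter> H k)"
proof -
  have Hk: "vec.subspace (H k)" "vec.dim (H k) + 1 = CARD('m)"
    using arrangement k by (auto simp: central_arrangement_def linear_hyperplane_def)
  have XH: "vec.subspace (X \<inter> H k)" using X k lat_Int_hyperplane lat_subspace by blast
  have "vec.dim {x + y | x y. x \<in> X \<and> y \<in> H k} + vec.dim (X \<inter> H k) = vec.dim X + vec.dim (H k)"
    by (rule vec.dim_sums_Int) (use X Hk lat_subspace in auto)
  moreover have "vec.dim {x + y | x y. x \<in> X \<and> y \<in> H k} \<le> CARD('m)"
    by (rule dim_subset_UNIV_cart_gen)
  ultimately have "vec.dim X \<le> vec.dim (X \<inter> H k) + 1" using Hk by linarith
  moreover have "\<not> vec.dim X \<le> vec.dim (X \<inter> H k)"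
    using vec.subspace_dim_equal[OF XH lat_subspace[OF X]] assms(3) by blast
  ultimately have "codim (X \<inter> H k) = codim X + 1"
    using codim_add_dim[of X] codim_add_dim[of "X \<inter> H k"] by linarith
  then show ?thesis using X k by (auto simp: covers_def lat_Int_hyperplane)
qed

text \<open>\<open>Y\<close> lies in \<open>X \<inter> H k\<close> and has the same codimension.
  Hence \<open>X\<close> has a single cover inside \<open>H k\<close>; this uniqueness drives both
  the homotopy and part (b).\<close>

lemma covers_eq_Int_hyperplane:
  assumes "covers X Y" "k \<le> n" "\<not> X \<subseteq> H k" "Y \<subseteq> H k"
  shows "Y = X \<inter> H k"
proof (rule lat_eqI)
  show "codim Y = codim (X \<inter> H k)"
    using covers_Int_hyperplane[of X k] assms by (simp add: covers_def)
qed (use assms in \<open>auto simp: covers_def lat_Int_hyperplane\<close>)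

text \<open>Neither \<open>X\<close> nor \<open>Y\<close> lies in \<open>H k\<close>, so
  intersecting with it raises both codimensions by one.\<close>

lemma covers_Int_Int:
  assumes "covers X Y" "k \<le> n" "\<not> Y \<subseteq> H k"
  shows "covers (X \<inter> H k) (Y \<inter> H k)"
proof -
  have "\<not> X \<subseteq> H k" using assms by (auto simp: covers_def)
  then show ?thesis
    using covers_Int_hyperplane[of X k] covers_Int_hyperplane[of Y k] assms
    by (auto simp: covers_def)
qed

section \<open>Flags as saturated chains\<close>

text \<open>It suffices to compare neighbours: codimension \<open>r\<close> at index
  \<open>r\<close> means starting at 0 and growing by one, and strict inclusion is transitive. This
  local form is stable under splitting lists.\<close>

lemma flags_iff:
  "Xs \<in> flags H n \<longleftrightarrow> Xs \<noteq> [] \<and> hd Xs \<in> lat H n \<and> codim (hd Xs) = 0 \<and> successively covers Xs"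
proof
  assume "Xs \<in> flags H n"
  then obtain p where p: "is_flag H n p Xs" by (auto simp: flags_def)
  then have len: "length Xs = p + 1" and lat: "\<And>r. r \<le> p \<Longrightarrow> Xs ! r \<in> lat H n"
    and cod: "\<And>r. r \<le> p \<Longrightarrow> codim (Xs ! r) = r" and srt: "sorted_wrt (\<prec>) Xs"
    by (auto simp: is_flag_def)
  have "successively covers Xs"
    unfolding successively_conv_nth
  proof (intro allI impI)
    fix r assume r: "Suc r < length Xs"
    then have "Xs ! r \<prec> Xs ! Suc r" using srt by (simp add: sorted_wrt_iff_nth_less)
    then show "covers (Xs ! r) (Xs ! Suc r)"
      using r len lat[of r] lat[of "Suc r"] cod[of r] cod[of "Suc r"]
      by (auto simp: covers_def lat_less_def lat_le_def)
  qed
  then show "Xs \<noteq> [] \<and> hd Xs \<in> lat H n \<and> codim (hd Xs) = 0 \<and> successively covers Xs"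
    using len lat[of 0] cod[of 0] by (cases Xs) auto
next
  assume *: "Xs \<noteq> [] \<and> hd Xs \<in> lat H n \<and> codim (hd Xs) = 0 \<and> successively covers Xs"
  have nth: "Xs ! r \<in> lat H n \<and> codim (Xs ! r) = r" if "r < length Xs" for r
    using that
  proof (induction r)
    case 0
    then show ?case using * by (auto simp: hd_conv_nth)
  next
    case (Suc r)
    then show ?case using * by (auto simp: successively_conv_nth covers_def)
  qed
  have "successively (\<prec>) Xs"
    using * by (auto simp: lat_less_def lat_le_def covers_def elim!: successively_mono)
  then have "sorted_wrt (\<prec>) Xs"
    by (subst (asm) successively_conv_sorted_wrt)
      (auto simp: lat_less_def lat_le_def transp_def)
  moreover have "length Xs = length Xs - 1 + 1" using * by simp
  moreover have "set Xs \<subseteq> lat H n" using nth by (auto simp: in_set_conv_nth)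
  ultimately have "is_flag H n (length Xs - 1) Xs"
    using nth unfolding is_flag_def by auto
  then show "Xs \<in> flags H n" by (auto simp: flags_def)
qed

lemma flags_append_iff:
  assumes "As \<noteq> []" "Bs \<noteq> []"
  shows "As @ Bs \<in> flags H n \<longleftrightarrow> As \<in> flags H n \<and> covers (last As) (hd Bs) \<and> successively covers Bs"
  using assms by (auto simp: flags_iff successively_append_iff)

lemma flags_snoc_iff:
  assumes "As \<noteq> []"
  shows "As @ [X] \<in> flags H n \<longleftrightarrow> As \<in> flags H n \<and> covers (last As) X"
  using assms by (simp add: flags_append_iff)

lemma is_flag_iff: "is_flag H n p Xs \<longleftrightarrow> Xs \<in> flags H n \<and> length Xs = p + 1"
  by (auto simp: flags_def is_flag_def)

lemma codim_last: "Xs \<in> flags H n \<Longrightarrow> codim (last Xs) = length Xs - 1"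
  by (cases "Xs = []") (auto simp: flags_def is_flag_def last_conv_nth)

lemma last_in_lat: "Xs \<in> flags H n \<Longrightarrow> last Xs \<in> lat H n"
  by (cases "Xs = []") (auto simp: flags_def is_flag_def)

lemma finite_flags: "finite (flags H n)"
proof (rule finite_subset)
  show "flags H n \<subseteq> {Xs. set Xs \<subseteq> lat H n \<and> length Xs \<le> CARD('m) + 1}"
  proof
    fix Xs assume Xs: "Xs \<in> flags H n"
    then have "length Xs - 1 \<le> CARD('m)"
      using codim_last[OF Xs] codim_add_dim[of "last Xs"] by linarith
    then show "Xs \<in> {Xs. set Xs \<subseteq> lat H n \<and> length Xs \<le> CARD('m) + 1}"
      using Xs by (auto simp: flags_def is_flag_def)
  qed
  show "finite {Xs. set Xs \<subseteq> lat H n \<and> length Xs \<le> CARD('m) + 1}"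
    by (rule finite_lists_length_le[OF finite_lat])
qed

lemma finite_covers [simp]: "finite {Y. covers X Y}"
  by (rule finite_subset[OF _ finite_lat]) (auto simp: covers_def)

lemma finite_insert_flag [simp]: "finite {Y. As @ Y # Bs \<in> flags H n}"
  by (rule finite_subset[OF _ finite_lat]) (auto simp: flags_def is_flag_def)

section \<open>Functionals killing the relations, and the transpose of the differential\<close>

text \<open>\<open>As\<close> and \<open>Bs\<close> are nonempty because the relations vary inner
  entries only. If no flag has the given shape, the sum is empty and the condition holds
  trivially.\<close>

definition admissible :: "((complex ^ 'm) set list \<Rightarrow> complex) \<Rightarrow> bool"
  where "admissible \<phi> \<longleftrightarrow> (\<forall>As Bs. As \<noteq> [] \<longrightarrow> Bs \<noteq> [] \<longrightarrow>
    (\<Sum>Y | As @ Y # Bs \<in> flags H n. \<phi> (As @ Y # Bs)) = 0)"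

lemma admissibleD:
  "admissible \<phi> \<Longrightarrow> As \<noteq> [] \<Longrightarrow> Bs \<noteq> [] \<Longrightarrow>
    (\<Sum>Y | As @ Y # Bs \<in> flags H n. \<phi> (As @ Y # Bs)) = 0"
  by (simp add: admissible_def)

definition codiff ::
    "((complex ^ 'm) set list \<Rightarrow> complex) \<Rightarrow> (complex ^ 'm) set list \<Rightarrow> complex"
  where "codiff \<phi> Xs = (\<Sum>X | Xs @ [X] \<in> flags H n. \<phi> (Xs @ [X]))"

text \<open>Dual to \<open>d\<close> being well defined modulo the relations. Which \<open>X\<close>
  may be appended depends on \<open>last Bs\<close> only, so the sums can be exchanged; for fixed
  \<open>X\<close>, the sum over \<open>Y\<close> is a relation with \<open>Bs @ [X]\<close> in
  place of \<open>Bs\<close>.\<close>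

lemma admissible_codiff:
  assumes "admissible \<phi>"
  shows "admissible (codiff \<phi>)"
  unfolding admissible_def
proof (intro allI impI)
  fix As Bs :: "(complex ^ 'm) set list" assume ne: "As \<noteq> []" "Bs \<noteq> []"
  let ?S = "{Y. As @ Y # Bs \<in> flags H n}"
  have "(\<Sum>Y\<in>?S. codiff \<phi> (As @ Y # Bs))
      = (\<Sum>Y\<in>?S. \<Sum>X | covers (last Bs) X. \<phi> (As @ Y # (Bs @ [X])))"
    unfolding codiff_def
  proof (intro sum.cong refl)
    fix Y assume "Y \<in> ?S"
    then show "{X. (As @ Y # Bs) @ [X] \<in> flags H n} = {X. covers (last Bs) X}"
      using ne by (subst flags_snoc_iff) auto
  qed simp
  also have "\<dots> = (\<Sum>X | covers (last Bs) X. \<Sum>Y\<in>?S. \<phi> (As @ Y # (Bs @ [X])))"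
    by (rule sum.swap)
  also have "\<dots> = 0"
  proof (rule sum.neutral, intro ballI)
    fix X assume "X \<in> {X. covers (last Bs) X}"
    then have "As @ Y # (Bs @ [X]) \<in> flags H n \<longleftrightarrow> As @ Y # Bs \<in> flags H n" for Y
      using flags_snoc_iff[of "As @ Y # Bs" X] ne by simp
    then show "(\<Sum>Y\<in>?S. \<phi> (As @ Y # (Bs @ [X]))) = 0"
      using admissibleD[OF assms, of As "Bs @ [X]"] ne by simp
  qed
  finally show "(\<Sum>Y\<in>?S. codiff \<phi> (As @ Y # Bs)) = 0" .
qed

text \<open>Dual to \<open>d d = 0\<close>: for a fixed last entry \<open>Z\<close>, the sum over
  the intermediate \<open>X\<close> is a relation.\<close>

lemma codiff_codiff:
  assumes "admissible \<phi>" "Xs \<in> flags H n"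
  shows "codiff (codiff \<phi>) Xs = 0"
proof -
  have ne: "Xs \<noteq> []" using assms by (simp add: flags_iff)
  have "codiff (codiff \<phi>) Xs =
      (\<Sum>X | covers (last Xs) X. \<Sum>Z | covers X Z. \<phi> (Xs @ [X, Z]))"
    unfolding codiff_def using ne assms by (simp add: flags_append_iff)
  \<comment> \<open>Letting \<open>Z\<close> range over the whole lattice with a side condition
    allows the two sums to be exchanged.\<close>
  also have "\<dots> = (\<Sum>X | covers (last Xs) X. \<Sum>Z\<in>{Z\<in>lat H n. covers X Z}. \<phi> (Xs @ [X, Z]))"
    by (intro sum.cong) (auto simp: covers_def)
  also have "\<dots> = (\<Sum>Z\<in>lat H n. \<Sum>X\<in>{X\<in>{X. covers (last Xs) X}. covers X Z}. \<phi> (Xs @ [X, Z]))"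
    by (rule sum.swap_restrict) (auto simp: finite_lat)
  also have "\<dots> = (\<Sum>Z\<in>lat H n. \<Sum>X | Xs @ X # [Z] \<in> flags H n. \<phi> (Xs @ [X, Z]))"
    using ne assms by (intro sum.cong) (auto simp: flags_append_iff)
  also have "\<dots> = 0"
    using admissibleD[OF assms(1) ne, of "[_]"] by simp
  finally show ?thesis .
qed

end

subsection \<open>A contracting homotopy\<close>

locale arrangement_hyperplane = arrangement H n
  for H :: "nat \<Rightarrow> (complex ^ 'm) set" and n +
  fixes j :: nat
  assumes j: "j \<le> n"
begin

text \<open>Transpose of the map that extends a flag by an entry \<open>Y\<close> outside
  \<open>H j\<close> lying between its last entry and \<open>X\<close>. The bound \<open>X\<close>
  restricts \<open>Y\<close> but does not enter the argument of \<open>\<phi>\<close>.\<close>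

definition expand ::
    "(complex ^ 'm) set \<Rightarrow> ((complex ^ 'm) set list \<Rightarrow> complex) \<Rightarrow> (complex ^ 'm) set list \<Rightarrow> complex"
  where "expand X \<phi> Zs = (\<Sum>Y | Zs @ [Y, X] \<in> flags H n \<and> \<not> Y \<subseteq> H j. \<phi> (Zs @ [Y]))"

text \<open>The transpose of \<open>h\<close>. The last case comes from the component at \<open>X\<close> of the homotopy formula
  \<open>h d + d h = id\<close>: for \<open>P \<subseteq> H j\<close>, the flag \<open>[\<dots> < P < X]\<close> goes to minus the sum of all one-step
  extensions of \<open>h[\<dots> < P]\<close> lying between its last entry and \<open>X\<close> and outside \<open>H j\<close>.\<close>

function contract ::
    "((complex ^ 'm) set list \<Rightarrow> complex) \<Rightarrow> (complex ^ 'm) set list \<Rightarrow> complex"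
  where "contract \<phi> Xs =
    (if length Xs < 2 \<or> \<not> last Xs \<subseteq> H j then 0
     else if \<not> last (butlast Xs) \<subseteq> H j then \<phi> (butlast Xs)
     else - contract (expand (last Xs) \<phi>) (butlast Xs))"
  by auto
termination
  by (relation "measure (length \<circ> snd)") auto

declare contract.simps [simp del]

lemma contract_snoc:
  assumes "Xs \<noteq> []"
  shows "contract \<phi> (Xs @ [X]) =
    (if \<not> X \<subseteq> H j then 0 else if \<not> last Xs \<subseteq> H j then \<phi> Xs else - contract (expand X \<phi>) Xs)"
  using assms by (subst contract.simps) (cases Xs, auto)

lemma contract_singleton [simp]: "contract \<phi> [X] = 0"
  by (subst contract.simps) simp

text \<open>The range \<open>?T\<close> of the appended entry depends only on \<open>last Bs\<close>
  and \<open>X\<close>, so the exchange of sums used for \<open>codiff\<close> applies.\<close>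

lemma admissible_expand:
  assumes "admissible \<phi>"
  shows "admissible (expand X \<phi>)"
  unfolding admissible_def
proof (intro allI impI)
  fix As Bs :: "(complex ^ 'm) set list" assume ne: "As \<noteq> []" "Bs \<noteq> []"
  let ?S = "{Y. As @ Y # Bs \<in> flags H n}"
  let ?T = "{V. covers (last Bs) V \<and> covers V X \<and> \<not> V \<subseteq> H j}"
  have "(\<Sum>Y\<in>?S. expand X \<phi> (As @ Y # Bs)) = (\<Sum>Y\<in>?S. \<Sum>V\<in>?T. \<phi> (As @ Y # (Bs @ [V])))"
    unfolding expand_def
  proof (intro sum.cong refl)
    fix Y assume "Y \<in> ?S"
    then show "{V. (As @ Y # Bs) @ [V, X] \<in> flags H n \<and> \<not> V \<subseteq> H j} = ?T"
      using ne by (subst flags_append_iff) auto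
  qed simp
  also have "\<dots> = (\<Sum>V\<in>?T. \<Sum>Y\<in>?S. \<phi> (As @ Y # (Bs @ [V])))"
    by (rule sum.swap)
  also have "\<dots> = 0"
  proof (rule sum.neutral, intro ballI)
    fix V assume "V \<in> ?T"
    then have "As @ Y # (Bs @ [V]) \<in> flags H n \<longleftrightarrow> As @ Y # Bs \<in> flags H n" for Y
      using flags_snoc_iff[of "As @ Y # Bs" V] ne by simp
    then show "(\<Sum>Y\<in>?S. \<phi> (As @ Y # (Bs @ [V]))) = 0"
      using admissibleD[OF assms, of As "Bs @ [V]"] ne by simp
  qed
  finally show "(\<Sum>Y\<in>?S. expand X \<phi> (As @ Y # Bs)) = 0" .
qed

lemma expand_sum: "expand X (\<lambda>Zs. \<Sum>k\<in>K. f k Zs) Zs = (\<Sum>k\<in>K. expand X (f k) Zs)"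
  unfolding expand_def by (rule sum.swap)

text \<open>Unfolding the recursion, \<open>\<phi>\<close> is evaluated only at flags that end
  outside \<open>H j\<close>, one step before \<open>last Xs\<close>. It is at such flags that
  \<open>sum_expand_expand\<close> gives a vanishing sum.\<close>

lemma contract_cong:
  assumes "Xs \<in> flags H n"
    and "\<And>Zs. Zs \<in> flags H n \<Longrightarrow> covers (last Zs) (last Xs) \<Longrightarrow> \<not> last Zs \<subseteq> H j \<Longrightarrow> \<phi> Zs = \<psi> Zs"
  shows "contract \<phi> Xs = contract \<psi> Xs"
  using assms
proof (induction Xs arbitrary: \<phi> \<psi> rule: rev_induct)
  case Nil
  then show ?case by (simp add: flags_iff)
next
  case (snoc X Xs)
  show ?case
  proof (cases "Xs = []")
    case False
    then have Xs: "Xs \<in> flags H n" "covers (last Xs) X"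
      using snoc.prems(1) by (auto simp: flags_snoc_iff)
    have "contract (expand X \<phi>) Xs = contract (expand X \<psi>) Xs"
    proof (rule snoc.IH[OF Xs(1)])
      fix Zs assume "Zs \<in> flags H n"
      then have "Zs \<noteq> []" by (simp add: flags_iff)
      then show "expand X \<phi> Zs = expand X \<psi> Zs"
        unfolding expand_def
        by (intro sum.cong snoc.prems(2) refl) (auto simp: flags_append_iff)
    qed
    then show ?thesis
      using False Xs snoc.prems(2)[of Xs] by (auto simp: contract_snoc)
  qed simp
qed

lemma contract_sum:
  "Xs \<noteq> [] \<Longrightarrow> contract (\<lambda>Zs. \<Sum>k\<in>K. f k Zs) Xs = (\<Sum>k\<in>K. contract (f k) Xs)"
proof (induction Xs arbitrary: f rule: rev_induct)
  case (snoc X Xs)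
  have "expand X (\<lambda>Zs. \<Sum>k\<in>K. f k Zs) = (\<lambda>Zs. \<Sum>k\<in>K. expand X (f k) Zs)"
    by (rule ext) (rule expand_sum)
  then show ?case
    using snoc.IH[of "\<lambda>k. expand X (f k)"]
    by (cases "Xs = []") (auto simp: contract_snoc sum_negf)
qed simp

lemma contract_zero: "Xs \<in> flags H n \<Longrightarrow> contract (\<lambda>_. 0) Xs = 0"
  using contract_sum[of Xs _ "{}"] by (simp add: flags_iff)

text \<open>A triple \<open>Y, W, V\<close> occurring in this sum is determined by \<open>W\<close> and \<open>V\<close>, as \<open>Y = W \<inter> H j\<close>; for
  fixed \<open>V\<close>, the sum over \<open>W\<close> is a relation.\<close>

lemma sum_expand_expand:
  assumes adm: "admissible \<phi>" and Zs: "Zs \<in> flags H n"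
    and ZP: "covers (last Zs) P" "\<not> last Zs \<subseteq> H j" "P \<subseteq> H j" and X: "X \<subseteq> H j"
  shows "(\<Sum>Y | covers P Y \<and> covers Y X. expand Y (expand X \<phi>) Zs) = 0"
proof -
  let ?Z = "last Zs"
  let ?B = "{Y. covers P Y \<and> covers Y X}"
  let ?C = "\<lambda>Y. {W. covers ?Z W \<and> covers W Y \<and> \<not> W \<subseteq> H j}"
  let ?D = "\<lambda>W. {V. covers W V \<and> covers V X \<and> \<not> V \<subseteq> H j}"
  let ?E = "{V. covers V X \<and> \<not> V \<subseteq> H j}"
  let ?F = "\<lambda>V. {W. covers ?Z W \<and> covers W V}"
  have ne: "Zs \<noteq> []" using Zs by (simp add: flags_iff)
  have fin [simp]: "finite {Y. covers P Y \<and> Q Y}" "finite {Y. covers Y X \<and> Q Y}" for P Q X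
    by (rule finite_subset[OF _ finite_lat]; auto simp: covers_def)+
  have P: "P = ?Z \<inter> H j" using covers_eq_Int_hyperplane ZP j by blast
  have "(\<Sum>Y\<in>?B. expand Y (expand X \<phi>) Zs)
      = (\<Sum>Y\<in>?B. \<Sum>W\<in>?C Y. \<Sum>V\<in>?D W. \<phi> (Zs @ [W, V]))"
    unfolding expand_def using Zs ne
    by (intro sum.cong) (auto simp: flags_append_iff conj_assoc)
  also have "\<dots> = (\<Sum>(Y, W, V) \<in> (SIGMA Y:?B. SIGMA W:?C Y. ?D W). \<phi> (Zs @ [W, V]))"
    by (simp add: sum.Sigma)
  also have "\<dots> = (\<Sum>(V, W) \<in> (SIGMA V:?E. ?F V). \<phi> (Zs @ [W, V]))"
  proof (rule sum.reindex_bij_witness[where i = "\<lambda>(V, W). (W \<inter> H j, W, V)" and j = "\<lambda>(Y, W, V). (V, W)"])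
    fix a assume "a \<in> (SIGMA V:?E. ?F V)"
    then obtain V W where a: "a = (V, W)" "covers V X" "\<not> V \<subseteq> H j" "covers ?Z W" "covers W V" by auto
    then have W: "\<not> W \<subseteq> H j" by (auto simp: covers_def)
    \<comment> \<open>\<open>X\<close> and \<open>P\<close> are the traces on \<open>H j\<close> of
      \<open>V\<close> and \<open>last Zs\<close>, so the trace of \<open>W\<close> fits between
      them.\<close>
    have "X = V \<inter> H j" using covers_eq_Int_hyperplane a X j by blast
    then have "covers (W \<inter> H j) X" using covers_Int_Int a j by blast
    moreover have "covers P (W \<inter> H j)" using covers_Int_Int P W a j by blast
    moreover have "covers W (W \<inter> H j)" using covers_Int_hyperplane W a j by (auto simp: covers_def)
    ultimately show "(case a of (V, W) \<Rightarrow> (W \<inter> H j, W, V)) \<in> (SIGMA Y:?B. SIGMA W:?C Y. ?D W)"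
      using a W by auto
  next
    fix a assume "a \<in> (SIGMA Y:?B. SIGMA W:?C Y. ?D W)"
    then obtain Y W V where a: "a = (Y, W, V)" "covers P Y" "covers Y X" "covers ?Z W" "covers W Y"
      "\<not> W \<subseteq> H j" "covers W V" "covers V X" "\<not> V \<subseteq> H j" by auto
    then have "Y \<subseteq> H j" using P by (auto simp: covers_def)
    then have "Y = W \<inter> H j" using covers_eq_Int_hyperplane a j by blast
    then show "(case case a of (Y, W, V) \<Rightarrow> (V, W) of (V, W) \<Rightarrow> (W \<inter> H j, W, V)) = a"
      using a by simp
  qed auto
  also have "\<dots> = (\<Sum>V\<in>?E. \<Sum>W\<in>?F V. \<phi> (Zs @ [W, V]))"
    by (simp add: sum.Sigma)
  also have "\<dots> = 0"
  proof (rule sum.neutral, intro ballI)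
    fix V
    have "?F V = {W. Zs @ W # [V] \<in> flags H n}" using Zs ne by (auto simp: flags_append_iff)
    then show "(\<Sum>W\<in>?F V. \<phi> (Zs @ [W, V])) = 0"
      using admissibleD[OF adm ne, of "[V]"] by simp
  qed
  finally show ?thesis .
qed

section \<open>Compatibility of the homotopy with the relations\<close>

text \<open>These are the relations in which the varying entry precedes the last one. Let
  \<open>X \<subseteq> H j\<close>. If \<open>last As \<subseteq> H j\<close>, every
  \<open>Y\<close> lies in \<open>H j\<close> and the double expansion sums to 0; otherwise the
  single \<open>Y = last As \<inter> H j\<close> contributes minus the sum of the other
  terms.\<close>

lemma sum_contract_penultimate:
  assumes adm: "admissible \<phi>" and As: "As \<noteq> []"
  shows "(\<Sum>Y | As @ [Y, X] \<in> flags H n. contract \<phi> (As @ [Y, X])) = 0"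
proof (cases "As \<in> flags H n \<and> X \<subseteq> H j")
  case True
  let ?P = "last As"
  let ?B = "{Y. covers ?P Y \<and> covers Y X}"
  have B: "{Y. As @ [Y, X] \<in> flags H n} = ?B"
    using True As by (auto simp: flags_append_iff)
  have fin: "finite ?B" by (rule finite_subset[OF _ finite_lat]) (auto simp: covers_def)
  have con: "contract \<phi> (As @ [Y, X]) =
      (if \<not> Y \<subseteq> H j then \<phi> (As @ [Y]) else - contract (expand X \<phi>) (As @ [Y]))" for Y
    using contract_snoc[of "As @ [Y]" \<phi> X] True by simp
  show ?thesis
  proof (cases "?P \<subseteq> H j")
    case P: True
    have "(\<Sum>Y\<in>?B. contract \<phi> (As @ [Y, X])) = (\<Sum>Y\<in>?B. contract (expand Y (expand X \<phi>)) As)"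
    proof (intro sum.cong refl)
      fix Y assume "Y \<in> ?B"
      then have "Y \<subseteq> H j" using P by (auto simp: covers_def)
      \<comment> \<open>The recursion is unfolded twice, and the two signs cancel.\<close>
      then show "contract \<phi> (As @ [Y, X]) = contract (expand Y (expand X \<phi>)) As"
        using con P As by (simp add: contract_snoc)
    qed
    also have "\<dots> = contract (\<lambda>Zs. \<Sum>Y\<in>?B. expand Y (expand X \<phi>) Zs) As"
      using As by (simp add: contract_sum)
    also have "\<dots> = contract (\<lambda>_. 0) As"
      using True P by (intro contract_cong sum_expand_expand adm) auto
    finally show ?thesis using True B by (simp add: contract_zero)
  next
    case P: False
    have "(\<Sum>Y\<in>?B. contract \<phi> (As @ [Y, X])) =
        (\<Sum>Y\<in>?B. (if Y \<subseteq> H j then - expand X \<phi> As else \<phi> (As @ [Y])))"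
      using P As by (intro sum.cong) (auto simp: con contract_snoc)
    also have "\<dots> = (\<Sum>Y\<in>{Y\<in>?B. Y \<subseteq> H j}. - expand X \<phi> As)
        + (\<Sum>Y\<in>{Y\<in>?B. \<not> Y \<subseteq> H j}. \<phi> (As @ [Y]))"
      using fin by (simp add: sum.If_cases Collect_conj_eq[symmetric] Int_def Collect_neg_eq[symmetric])
    also have "(\<Sum>Y\<in>{Y\<in>?B. \<not> Y \<subseteq> H j}. \<phi> (As @ [Y])) = expand X \<phi> As"
      unfolding expand_def using True As
      by (intro sum.cong) (auto simp: flags_append_iff)
    also have "(\<Sum>Y\<in>{Y\<in>?B. Y \<subseteq> H j}. - expand X \<phi> As) + expand X \<phi> As = 0"
    proof (cases "?B = {}")
      \<comment> \<open>Since \<open>X\<close> is arbitrary, there may be nothing between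
        \<open>last As\<close> and \<open>X\<close>; both summands are then empty sums.\<close>
      case empty: True
      then have "{Y. As @ [Y, X] \<in> flags H n \<and> \<not> Y \<subseteq> H j} = {}" using B by auto
      then have "expand X \<phi> As = 0" unfolding expand_def by (simp only: sum.empty)
      then show ?thesis by simp
    next
      case False
      then obtain Y where Y: "covers ?P Y" "covers Y X" by blast
      have PH: "covers ?P (?P \<inter> H j)" using covers_Int_hyperplane P Y j by (auto simp: covers_def)
      \<comment> \<open>One intermediate \<open>Y\<close> shows that the codimension of
        \<open>X\<close> exceeds that of \<open>last As\<close> by two, so
        \<open>last As \<inter> H j\<close> is intermediate as well.\<close>
      then have "covers (?P \<inter> H j) X" using Y True by (auto simp: covers_def)
      then have "{Y\<in>?B. Y \<subseteq> H j} = {?P \<inter> H j}"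
        using PH covers_eq_Int_hyperplane[OF _ j P] by blast
      then show ?thesis by simp
    qed
    finally show ?thesis using B by simp
  qed
next
  case False
  then have "As @ [Y, X] \<in> flags H n \<Longrightarrow> contract \<phi> (As @ [Y, X]) = 0" for Y
    using contract_snoc[of "As @ [Y]" \<phi> X] As by (auto simp: flags_append_iff)
  then show ?thesis by (simp add: sum.neutral)
qed

text \<open>Dual to \<open>h\<close> being well defined modulo the relations. Induction from the end
  of \<open>Bs\<close>: away from \<open>Y\<close>, the recursion leaves 0, \<open>\<phi>\<close> or
  minus \<open>contract (expand X \<phi>)\<close> on the shorter list, and all of these satisfy the
  relation. Since \<open>\<phi>\<close> is replaced by \<open>expand X \<phi>\<close>, it is kept
  arbitrary.\<close>

lemma admissible_contract:
  assumes "admissible \<phi>"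
  shows "admissible (contract \<phi>)"
  unfolding admissible_def
proof (intro allI impI)
  fix As Bs :: "(complex ^ 'm) set list" assume ne: "As \<noteq> []" "Bs \<noteq> []"
  show "(\<Sum>Y | As @ Y # Bs \<in> flags H n. contract \<phi> (As @ Y # Bs)) = 0"
    using ne(2) assms
  proof (induction Bs arbitrary: \<phi> rule: rev_induct)
    case (snoc X Bs)
    show ?case
    proof (cases "Bs = []")
      case True
      then show ?thesis using sum_contract_penultimate snoc.prems ne(1) by simp
    next
      case False
      have con: "contract \<phi> (As @ Y # Bs @ [X]) =
          (if \<not> X \<subseteq> H j then 0 else if \<not> last Bs \<subseteq> H j then \<phi> (As @ Y # Bs)
           else - contract (expand X \<phi>) (As @ Y # Bs))" for Y
        using contract_snoc[of "As @ Y # Bs" \<phi> X] False by simp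
      have S: "{Y. As @ Y # Bs @ [X] \<in> flags H n} =
          (if covers (last Bs) X then {Y. As @ Y # Bs \<in> flags H n} else {})"
        using flags_snoc_iff[of "As @ _ # Bs" X] False by auto
      show ?thesis
        unfolding con S
        using snoc.IH[OF False admissible_expand[OF snoc.prems(2)]]
          admissibleD[OF snoc.prems(2) ne(1) False]
        by (cases "X \<subseteq> H j"; cases "last Bs \<subseteq> H j") (simp_all add: sum_negf)
    qed
  qed simp
qed

text \<open>Transpose of \<open>h d G = G\<close>: among the extensions of \<open>Xs\<close> by one
  entry, only that by \<open>last Xs \<inter> H j\<close> ends inside \<open>H j\<close>, and there
  \<open>contract\<close> returns \<open>\<phi> Xs\<close>.\<close>

lemma codiff_contract:
  assumes Xs: "Xs \<in> flags H n" and nH: "\<not> last Xs \<subseteq> H j"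
  shows "codiff (contract \<phi>) Xs = \<phi> Xs"
proof -
  have ne: "Xs \<noteq> []" using Xs by (simp add: flags_iff)
  have cov: "covers (last Xs) (last Xs \<inter> H j)"
    using covers_Int_hyperplane nH j last_in_lat[OF Xs] by blast
  have iff: "X \<subseteq> H j \<longleftrightarrow> X = last Xs \<inter> H j" if "covers (last Xs) X" for X
    using covers_eq_Int_hyperplane[OF that j nH] by blast
  have "codiff (contract \<phi>) Xs =
      (\<Sum>X | covers (last Xs) X. if X = last Xs \<inter> H j then \<phi> Xs else 0)"
    unfolding codiff_def using Xs ne nH
    by (intro sum.cong) (simp_all add: flags_snoc_iff contract_snoc iff)
  also have "\<dots> = \<phi> Xs" using cov by (simp add: sum.delta)
  finally show ?thesis .
qed

end

subsection \<open>The differential and the transition maps\<close>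

context arrangement
begin

section \<open>Chains and their pairing with functionals\<close>

abbreviation chains :: "((complex ^ 'm) set list \<Rightarrow> complex) set"
  where "chains \<equiv> carrier (flag_chains H n)"

lemma chains_iff: "c \<in> chains \<longleftrightarrow> (\<forall>Xs. Xs \<notin> flags H n \<longrightarrow> c Xs = 0)"
  by (simp add: carrier_free_module finite_flags)

lemma chains_zero [simp]: "0 \<in> chains"
  and chains_add [simp]: "a \<in> chains \<Longrightarrow> b \<in> chains \<Longrightarrow> a + b \<in> chains"
  and chains_diff [simp]: "a \<in> chains \<Longrightarrow> b \<in> chains \<Longrightarrow> a - b \<in> chains"
  and chains_uminus [simp]: "a \<in> chains \<Longrightarrow> - a \<in> chains"
  and chains_smult [simp]: "a \<in> chains \<Longrightarrow> (\<lambda>x. k * a x) \<in> chains"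
  by (simp_all add: chains_iff)

lemma chains_sum: "(\<And>k. k \<in> K \<Longrightarrow> f k \<in> chains) \<Longrightarrow> (\<Sum>k\<in>K. f k) \<in> chains"
  by (simp add: chains_iff sum_fun_apply)

lemma basis_elt_chains [simp]: "Xs \<in> flags H n \<Longrightarrow> basis_elt Xs \<in> chains"
  by (auto simp: chains_iff basis_elt_def)

definition pairing ::
    "((complex ^ 'm) set list \<Rightarrow> complex) \<Rightarrow> ((complex ^ 'm) set list \<Rightarrow> complex) \<Rightarrow> complex"
  where "pairing \<phi> c = (\<Sum>Xs\<in>flags H n. c Xs * \<phi> Xs)"

lemma pairing_add: "pairing \<phi> (a + b) = pairing \<phi> a + pairing \<phi> b"
  by (simp add: pairing_def distrib_right sum.distrib)

lemma pairing_diff: "pairing \<phi> (a - b) = pairing \<phi> a - pairing \<phi> b"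
  by (simp add: pairing_def left_diff_distrib sum_subtractf)

lemma pairing_smult: "pairing \<phi> (\<lambda>x. k * a x) = k * pairing \<phi> a"
  by (simp add: pairing_def sum_distrib_left mult.assoc)

lemma pairing_zero: "pairing \<phi> 0 = 0"
  by (simp add: pairing_def)

lemma pairing_sum: "pairing \<phi> (\<Sum>k\<in>K. f k) = (\<Sum>k\<in>K. pairing \<phi> (f k))"
  unfolding pairing_def sum_fun_apply sum_distrib_right by (rule sum.swap)

lemma pairing_basis_elt: "Xs \<in> flags H n \<Longrightarrow> pairing \<phi> (basis_elt Xs) = \<phi> Xs"
  by (simp add: pairing_def basis_elt_def finite_flags if_distrib[of "\<lambda>x. x * _"] cong: if_cong)

text \<open>Splitting a flag around position \<open>r\<close> turns indices into appended lists, the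
  form used by \<open>admissible\<close>. The flag \<open>As @ Y # Bs\<close> records that each
  relation arises from a flag by freeing one entry.\<close>

lemma flag_relations_eq:
  "flag_relations H n = {\<Sum>Y | As @ Y # Bs \<in> flags H n. basis_elt (As @ Y # Bs) | As Bs Y.
     As \<noteq> [] \<and> Bs \<noteq> [] \<and> As @ Y # Bs \<in> flags H n}" (is "_ = ?R")
proof -
  have rel: "(\<Oplus>\<^bsub>flag_chains H n\<^esub> Y \<in> {Y \<in> lat H n. Xs ! (r - 1) \<prec> Y \<and> Y \<prec> Xs ! (r + 1) \<and> codim Y = r}.
       basis_elt (Xs[r := Y])) = (\<Sum>Y | As @ Y # Bs \<in> flags H n. basis_elt (As @ Y # Bs))"
    if Xs: "Xs = As @ Z # Bs" "Xs \<in> flags H n" and ne: "As \<noteq> []" "Bs \<noteq> []" and r: "r = length As"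
    for Xs As Z Bs r
  proof -
    have As: "As \<in> flags H n" and Bs: "successively covers Bs"
      and Z: "covers (last As) Z" "covers Z (hd Bs)"
      using Xs ne by (auto simp: flags_append_iff successively_Cons)
    have r0: "r > 0" using ne r by simp
    have nth: "Xs ! (r - 1) = last As" "Xs ! (r + 1) = hd Bs" "codim (last As) + 1 = r"
      using Xs r ne codim_last[OF As] r0
      by (auto simp: nth_append last_conv_nth hd_conv_nth)
    \<comment> \<open>The neighbours have codimension \<open>r - 1\<close> and \<open>r + 1\<close>,
      so the strict inclusions together with \<open>codim Y = r\<close> amount to two
      covers.\<close>
    have set: "{Y \<in> lat H n. Xs ! (r - 1) \<prec> Y \<and> Y \<prec> Xs ! (r + 1) \<and> codim Y = r} =
        {Y. As @ Y # Bs \<in> flags H n}"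
    proof (rule Collect_cong)
      fix Y
      have lat: "last As \<in> lat H n" "hd Bs \<in> lat H n" and cod: "codim (hd Bs) = r + 1"
        using Z nth(3) by (simp_all add: covers_def)
      have "As @ Y # Bs \<in> flags H n \<longleftrightarrow> covers (last As) Y \<and> covers Y (hd Bs)"
        using As Bs ne by (simp add: flags_append_iff successively_Cons)
      also have "covers (last As) Y \<longleftrightarrow> Y \<in> lat H n \<and> last As \<prec> Y \<and> codim Y = r"
        using lat(1) nth(3) by (cases "last As = Y") (simp_all add: covers_def lat_less_def lat_le_def)
      also have "\<dots> \<and> covers Y (hd Bs) \<longleftrightarrow>
          Y \<in> lat H n \<and> last As \<prec> Y \<and> Y \<prec> hd Bs \<and> codim Y = r"
        using lat(2) cod
        by (cases "Y = hd Bs"; cases "codim Y = r"; cases "Y \<in> lat H n")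
          (simp_all add: covers_def lat_less_def lat_le_def)
      finally show "Y \<in> lat H n \<and> Xs ! (r - 1) \<prec> Y \<and> Y \<prec> Xs ! (r + 1) \<and> codim Y = r
          \<longleftrightarrow> As @ Y # Bs \<in> flags H n"
        unfolding nth(1,2) by blast
    qed
    have upd: "Xs[r := Y] = As @ Y # Bs" for Y using Xs r by simp
    show ?thesis unfolding set upd by (rule finsum_free_module) auto
  qed
  show ?thesis
  proof (intro equalityI subsetI)
    fix c assume "c \<in> flag_relations H n"
    then obtain Xs p r where c: "c = (\<Oplus>\<^bsub>flag_chains H n\<^esub> Y \<in> {Y \<in> lat H n. Xs ! (r - 1) \<prec> Y \<and>
        Y \<prec> Xs ! (r + 1) \<and> codim Y = r}. basis_elt (Xs[r := Y]))"
      and Xs: "is_flag H n p Xs" and r: "0 < r" "r < p"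
      unfolding flag_relations_def by blast
    have len: "r < length Xs" using Xs r by (simp add: is_flag_def)
    have split: "Xs = take r Xs @ Xs ! r # drop (Suc r) Xs" using len by (rule id_take_nth_drop)
    have ne: "take r Xs \<noteq> []" "drop (Suc r) Xs \<noteq> []" using Xs r by (auto simp: is_flag_def)
    have fl: "Xs \<in> flags H n" using Xs by (simp add: is_flag_iff)
    have "r = length (take r Xs)" using len by simp
    then have "c = (\<Sum>Y | take r Xs @ Y # drop (Suc r) Xs \<in> flags H n.
        basis_elt (take r Xs @ Y # drop (Suc r) Xs))"
      unfolding c by (rule rel[OF split fl ne])
    moreover have "take r Xs @ Xs ! r # drop (Suc r) Xs \<in> flags H n" using fl split by simp
    ultimately show "c \<in> ?R" using ne by blast
  next
    fix c assume "c \<in> ?R"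
    then obtain As Bs Y where c: "c = (\<Sum>Y | As @ Y # Bs \<in> flags H n. basis_elt (As @ Y # Bs))"
      and ne: "As \<noteq> []" "Bs \<noteq> []" and Y: "As @ Y # Bs \<in> flags H n" by blast
    have "is_flag H n (length As + length Bs) (As @ Y # Bs) \<and> 0 < length As
        \<and> length As < length As + length Bs"
      using Y ne by (simp add: is_flag_iff)
    then show "c \<in> flag_relations H n"
      unfolding flag_relations_def using rel[OF refl Y ne refl, symmetric] c by blast
  qed
qed

lemma flag_relations_subset: "flag_relations H n \<subseteq> chains"
  unfolding flag_relations_eq by (auto intro!: chains_sum)

lemma submodule_flag_rel_span: "submodule (flag_rel_span H n) CC (flag_chains H n)"
  unfolding flag_rel_span_def
  by (rule submodule_span_of[OF module_free_module flag_relations_subset])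

text \<open>The kernel of an admissible functional is a submodule containing the relations.
  Conversely, a chain outside the span is detected by a functional vanishing on the span, and such a
  functional is admissible.\<close>

lemma flag_rel_span_iff:
  assumes c: "c \<in> chains"
  shows "c \<in> flag_rel_span H n \<longleftrightarrow> (\<forall>\<phi>. admissible \<phi> \<longrightarrow> pairing \<phi> c = 0)"
proof (intro iffI allI impI)
  fix \<phi> assume cR: "c \<in> flag_rel_span H n" and adm: "admissible \<phi>"
  let ?K = "{a \<in> chains. pairing \<phi> a = 0}"
  have "submodule ?K CC (flag_chains H n)"
    by (rule submodule_free_moduleI) (auto simp: pairing_add pairing_zero pairing_smult)
  moreover have "flag_relations H n \<subseteq> ?K"
    using flag_relations_subset admissibleD[OF adm]
    by (auto simp: flag_relations_eq pairing_sum pairing_basis_elt)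
  ultimately show "pairing \<phi> c = 0"
    using cR unfolding flag_rel_span_def span_of_def by blast
next
  assume orth: "\<forall>\<phi>. admissible \<phi> \<longrightarrow> pairing \<phi> c = 0"
  show "c \<in> flag_rel_span H n"
  proof (rule ccontr)
    assume "c \<notin> flag_rel_span H n"
    then obtain \<phi> where \<phi>: "\<And>a. a \<in> flag_rel_span H n \<Longrightarrow> pairing \<phi> a = 0" "pairing \<phi> c = 1"
      using separating_functional[OF submodule_flag_rel_span finite_flags c]
      unfolding pairing_def by metis
    have "admissible \<phi>"
      unfolding admissible_def
    proof (intro allI impI)
      fix As Bs :: "(complex ^ 'm) set list" assume ne: "As \<noteq> []" "Bs \<noteq> []"
      let ?S = "{Y. As @ Y # Bs \<in> flags H n}"
      show "(\<Sum>Y\<in>?S. \<phi> (As @ Y # Bs)) = 0"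
      \<comment> \<open>\<open>flag_relations\<close> provides the sum only if some flag has this
        shape; otherwise the sum is empty.\<close>
      proof (cases "?S = {}")
        case False
        then have "(\<Sum>Y\<in>?S. basis_elt (As @ Y # Bs)) \<in> flag_relations H n"
          using ne unfolding flag_relations_eq by blast
        then have "pairing \<phi> (\<Sum>Y\<in>?S. basis_elt (As @ Y # Bs)) = 0"
          by (intro \<phi>) (auto simp: flag_rel_span_def span_of_def)
        then show ?thesis by (simp add: pairing_sum pairing_basis_elt)
      qed (simp only: sum.empty)
    qed
    then show False using orth \<phi>(2) by simp
  qed
qed

section \<open>Classes of chains in the flag space\<close>

sublocale F: submodule_quotient "flag_chains H n" "flag_rel_span H n"
  rewrites "quot_module (flag_chains H n) (flag_rel_span H n) = flag_space H n"
  by (rule submodule_quotient.intro[OF module_free_module submodule_flag_rel_span])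
    (simp only: flag_space_def)

lemma carrier_flag_space: "carrier (flag_space H n) = flag_proj H n ` chains"
  using F.carrier_quot_module by (simp add: flag_proj_def)

lemma flag_proj_closed [simp]: "a \<in> chains \<Longrightarrow> flag_proj H n a \<in> carrier (flag_space H n)"
  by (auto simp: carrier_flag_space)

lemma flag_proj_add:
  "a \<in> chains \<Longrightarrow> b \<in> chains \<Longrightarrow>
    flag_proj H n a \<oplus>\<^bsub>flag_space H n\<^esub> flag_proj H n b = flag_proj H n (a + b)"
  using F.add_coset[of a b] by (simp add: flag_proj_def)

lemma flag_proj_uminus:
  "a \<in> chains \<Longrightarrow> \<ominus>\<^bsub>flag_space H n\<^esub> flag_proj H n a = flag_proj H n (- a)"
  using F.uminus_coset[of a] by (simp add: flag_proj_def uminus_free_module)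

lemma flag_proj_smult:
  "a \<in> chains \<Longrightarrow> k \<odot>\<^bsub>flag_space H n\<^esub> flag_proj H n a = flag_proj H n (\<lambda>x. k * a x)"
  using F.smult_coset[of a k] by (simp add: flag_proj_def)

lemma flag_proj_sum:
  assumes "finite K" "\<And>k. k \<in> K \<Longrightarrow> f k \<in> chains"
  shows "(\<Oplus>\<^bsub>flag_space H n\<^esub> k\<in>K. flag_proj H n (f k)) = flag_proj H n (\<Sum>k\<in>K. f k)"
  using F.finsum_coset[of K f] finsum_free_module[of K f] assms by (simp add: flag_proj_def)

text \<open>From here on, equalities in the flag space are checked by pairing representatives with
  admissible functionals.\<close>

lemma flag_proj_eq_iff:
  assumes "a \<in> chains" "b \<in> chains"
  shows "flag_proj H n a = flag_proj H n b \<longleftrightarrow> (\<forall>\<phi>. admissible \<phi> \<longrightarrow> pairing \<phi> a = pairing \<phi> b)"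
  using F.coset_eq_iff[of a b] flag_rel_span_iff[of "a - b"] assms
  by (simp add: flag_proj_def uminus_free_module pairing_diff)

lemma flag_projI: "a \<in> flag_proj H n b \<Longrightarrow> b \<in> chains \<Longrightarrow> a \<in> chains \<and> flag_proj H n a = flag_proj H n b"
  unfolding flag_proj_def
  using F.M.a_repr_independence[OF _ _ F.N.a_subgroup] F.N.a_elemrcos_carrier by metis

section \<open>The differential on representatives\<close>

definition chain_diff ::
    "((complex ^ 'm) set list \<Rightarrow> complex) \<Rightarrow> (complex ^ 'm) set list \<Rightarrow> complex"
  where "chain_diff c =
    (\<Sum>Xs\<in>flags H n. (\<lambda>Zs. c Xs * (\<Sum>X | Xs @ [X] \<in> flags H n. basis_elt (Xs @ [X])) Zs))"

lemma chain_diff_chains [simp]: "chain_diff c \<in> chains"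
  unfolding chain_diff_def by (intro chains_sum chains_smult basis_elt_chains) auto

lemma pairing_chain_diff: "pairing \<phi> (chain_diff c) = pairing (codiff \<phi>) c"
  unfolding chain_diff_def pairing_sum pairing_smult codiff_def
  by (simp add: pairing_basis_elt) (simp add: pairing_def)

lemma pre_diff_eq: "pre_diff H n c = flag_proj H n (chain_diff c)"
proof -
  have "c Xs \<odot>\<^bsub>flag_space H n\<^esub>
      (\<Oplus>\<^bsub>flag_space H n\<^esub> X \<in> {X \<in> lat H n. last Xs \<prec> X \<and> codim X = codim (last Xs) + 1}.
        flag_class H n (Xs @ [X])) =
      flag_proj H n (\<lambda>Zs. c Xs * (\<Sum>X | Xs @ [X] \<in> flags H n. basis_elt (Xs @ [X])) Zs)"
    if Xs: "Xs \<in> flags H n" for Xs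
  proof -
    have "Xs \<noteq> []" using Xs by (simp add: flags_iff)
    then have S: "{X \<in> lat H n. last Xs \<prec> X \<and> codim X = codim (last Xs) + 1} = {X. Xs @ [X] \<in> flags H n}"
      using Xs last_in_lat[OF Xs] by (auto simp: flags_snoc_iff covers_def lat_less_def lat_le_def)
    show ?thesis
      unfolding S flag_class_def
      by (subst flag_proj_sum, simp, simp, subst flag_proj_smult) (auto intro!: chains_sum)
  qed
  then have "pre_diff H n c = (\<Oplus>\<^bsub>flag_space H n\<^esub> Xs\<in>flags H n.
      flag_proj H n (\<lambda>Zs. c Xs * (\<Sum>X | Xs @ [X] \<in> flags H n. basis_elt (Xs @ [X])) Zs))"
    unfolding pre_diff_def by (intro F.Q.finsum_cong') (auto intro!: flag_proj_closed chains_smult chains_sum)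
  then show ?thesis
    unfolding chain_diff_def
    by (subst (asm) flag_proj_sum) (auto intro!: finite_flags chains_smult chains_sum)
qed

text \<open>Representatives of one class pair equally with \<open>codiff \<phi>\<close>, which is
  again admissible. Hence \<open>pre_diff\<close> is constant on the class, and
  \<open>the_elem\<close> returns its only value.\<close>

lemma flag_diff_flag_proj:
  assumes c: "c \<in> chains"
  shows "flag_diff H n (flag_proj H n c) = flag_proj H n (chain_diff c)"
proof -
  have "pre_diff H n a = flag_proj H n (chain_diff c)" if "a \<in> flag_proj H n c" for a
    using flag_projI[OF that c] c
    by (auto simp: pre_diff_eq flag_proj_eq_iff pairing_chain_diff admissible_codiff)
  moreover have "c \<in> flag_proj H n c"
    using c by (simp add: flag_proj_def F.N.a_rcos_self)
  ultimately have "pre_diff H n ` flag_proj H n c = {flag_proj H n (chain_diff c)}" by blast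
  then show ?thesis by (simp add: flag_diff_def)
qed

lemma im_diff_eq: "im_diff H n = (\<lambda>c. flag_proj H n (chain_diff c)) ` chains"
  unfolding im_diff_def carrier_flag_space by (auto simp: image_iff flag_diff_flag_proj)

section \<open>Congruence modulo the image of the differential\<close>

lemma red_proj_eq:
  assumes "g \<in> chains"
  shows "red_proj H n (flag_proj H n g) = (\<lambda>c. flag_proj H n (chain_diff c + g)) ` chains"
  unfolding red_proj_def im_diff_eq a_r_coset_def' using assms by (auto simp: flag_proj_add)

lemma red_proj_eq_iff:
  assumes "f \<in> chains" "g \<in> chains"
  shows "red_proj H n (flag_proj H n g) = red_proj H n (flag_proj H n f) \<longleftrightarrow>
    (\<exists>c\<in>chains. \<forall>\<phi>. admissible \<phi> \<longrightarrow> pairing \<phi> g = pairing (codiff \<phi>) c + pairing \<phi> f)"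
proof
  assume eq: "red_proj H n (flag_proj H n g) = red_proj H n (flag_proj H n f)"
  \<comment> \<open>A coset contains its own representative, here obtained from the zero
    chain.\<close>
  have "flag_proj H n (chain_diff 0 + g) \<in> red_proj H n (flag_proj H n g)"
    using assms by (auto simp: red_proj_eq)
  then obtain c where "c \<in> chains" "flag_proj H n (chain_diff 0 + g) = flag_proj H n (chain_diff c + f)"
    unfolding eq using assms by (auto simp: red_proj_eq)
  then show "\<exists>c\<in>chains. \<forall>\<phi>. admissible \<phi> \<longrightarrow> pairing \<phi> g = pairing (codiff \<phi>) c + pairing \<phi> f"
    using assms by (auto simp: flag_proj_eq_iff pairing_add pairing_chain_diff pairing_zero)
next
  assume "\<exists>c\<in>chains. \<forall>\<phi>. admissible \<phi> \<longrightarrow> pairing \<phi> g = pairing (codiff \<phi>) c + pairing \<phi> f"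
  then obtain c where c: "c \<in> chains"
    "\<And>\<phi>. admissible \<phi> \<Longrightarrow> pairing \<phi> g = pairing (codiff \<phi>) c + pairing \<phi> f" by blast
  \<comment> \<open>Translation by \<open>c\<close> carries either parametrization of the coset into
    the other.\<close>
  have shift: "flag_proj H n (chain_diff a + g) = flag_proj H n (chain_diff (a + c) + f)"
    "flag_proj H n (chain_diff a + f) = flag_proj H n (chain_diff (a - c) + g)" if "a \<in> chains" for a
    using assms c that
    by (simp_all add: flag_proj_eq_iff pairing_add pairing_diff pairing_chain_diff)
  show "red_proj H n (flag_proj H n g) = red_proj H n (flag_proj H n f)"
    unfolding red_proj_eq[OF assms(1)] red_proj_eq[OF assms(2)]
    by (intro equalityI image_subsetI; rule image_eqI, erule shift) (simp_all add: c(1))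
qed

section \<open>Dehomogenized spaces as spaces of supported chains\<close>

text \<open>A chain supported on these flags splits according to their last entries; conversely,
  representatives chosen in the separate components add up to such a chain.\<close>

lemma dehom_space_eq:
  "dehom_space H n p k = flag_proj H n `
    carrier (free_module {Xs. is_flag H n p Xs \<and> \<not> H k \<preceq> last Xs})"
proof -
  let ?S = "{X \<in> lat H n. codim X = p \<and> \<not> H k \<preceq> X}"
  let ?A = "\<lambda>X. {Xs. is_flag H n p Xs \<and> last Xs = X}"
  let ?B = "{Xs. is_flag H n p Xs \<and> \<not> H k \<preceq> last Xs}"
  have A: "?A X \<subseteq> flags H n" for X by (auto simp: is_flag_iff)
  have B: "?B \<subseteq> flags H n" by (auto simp: is_flag_iff)
  have finA: "finite (?A X)" for X using A finite_flags finite_subset by blast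
  have finB: "finite ?B" using B finite_flags finite_subset by blast
  have finS: "finite ?S" using finite_lat by simp
  have comp: "flag_comp H n p X = flag_proj H n ` carrier (free_module (?A X))" for X
  proof -
    have "{basis_elt Xs | Xs. is_flag H n p Xs \<and> last Xs = X} = basis_elt ` ?A X" by auto
    then show ?thesis unfolding flag_comp_def by (simp only: span_of_basis_elts[OF finite_flags A])
  qed
  have AB: "carrier (free_module (?A X)) \<subseteq> carrier (free_module ?B)" if "X \<in> ?S" for X
    using that by (intro carrier_free_module_mono) auto
  have Bc: "carrier (free_module ?B) \<subseteq> chains"
    by (rule carrier_free_module_mono[OF B])
  show ?thesis
  proof (intro equalityI subsetI)
    fix F assume "F \<in> dehom_space H n p k"
    then obtain g where F: "F = (\<Oplus>\<^bsub>flag_space H n\<^esub> X \<in> ?S. g X)"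
      and g: "g \<in> (\<Pi> X\<in>?S. flag_comp H n p X)"
      unfolding dehom_space_def Let_def by blast
    then have "\<forall>X\<in>?S. \<exists>c. c \<in> carrier (free_module (?A X)) \<and> g X = flag_proj H n c"
      unfolding comp by blast
    from bchoice[OF this] obtain c
      where "\<forall>X\<in>?S. c X \<in> carrier (free_module (?A X)) \<and> g X = flag_proj H n (c X)" ..
    then have c: "\<And>X. X \<in> ?S \<Longrightarrow> c X \<in> carrier (free_module (?A X))"
      "\<And>X. X \<in> ?S \<Longrightarrow> g X = flag_proj H n (c X)" by blast+
    have cB: "c X \<in> carrier (free_module ?B)" if "X \<in> ?S" for X using c(1)[OF that] AB[OF that] by blast
    then have cC: "c X \<in> chains" if "X \<in> ?S" for X using Bc that by blast
    have "F = (\<Oplus>\<^bsub>flag_space H n\<^esub> X \<in> ?S. flag_proj H n (c X))"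
      unfolding F using cC c(2) by (intro F.Q.finsum_cong') auto
    then have "F = flag_proj H n (\<Sum>X\<in>?S. c X)"
      using flag_proj_sum[OF finS cC] by simp
    moreover have "(\<Sum>X\<in>?S. c X) \<in> carrier (free_module ?B)"
      using cB by (simp add: carrier_free_module[OF finB] sum_fun_apply)
    ultimately show "F \<in> flag_proj H n ` carrier (free_module ?B)" by blast
  next
    fix F assume "F \<in> flag_proj H n ` carrier (free_module ?B)"
    then obtain c where F: "F = flag_proj H n c" and c: "c \<in> carrier (free_module ?B)" by blast
    \<comment> \<open>\<open>d X\<close> is the part of \<open>c\<close> on the flags that end at
      \<open>X\<close>.\<close>
    define d where "d X = (\<lambda>Xs. if last Xs = X then c Xs else 0)" for X
    have dA: "d X \<in> carrier (free_module (?A X))" for X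
      using c by (auto simp: d_def carrier_free_module finA finB)
    then have dC: "d X \<in> chains" for X
      using carrier_free_module_mono[OF A] by blast
    have "(\<Sum>X\<in>?S. d X) = c"
    proof
      fix Xs
      have "last Xs \<in> ?S" if "c Xs \<noteq> 0"
      proof -
        have "is_flag H n p Xs" "\<not> H k \<preceq> last Xs"
          using c that by (auto simp: carrier_free_module finB)
        then show ?thesis using last_in_lat[of Xs] codim_last[of Xs] by (simp add: is_flag_iff)
      qed
      then show "(\<Sum>X\<in>?S. d X) Xs = c Xs"
        using finS by (auto simp: sum_fun_apply d_def)
    qed
    then have "F = (\<Oplus>\<^bsub>flag_space H n\<^esub> X \<in> ?S. flag_proj H n (d X))"
      unfolding F using flag_proj_sum[OF finS dC] by simp
    moreover have "(\<lambda>X. flag_proj H n (d X)) \<in> (\<Pi> X\<in>?S. flag_comp H n p X)"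
      using dA by (auto simp: comp)
    ultimately show "F \<in> dehom_space H n p k"
      unfolding dehom_space_def Let_def by blast
  qed
qed

end

section \<open>Injectivity of the projection and the transition formulas\<close>

text \<open>Equal images mean that \<open>f - g\<close> is \<open>d c\<close> modulo relations.
  Testing this against \<open>codiff (contract \<phi>)\<close> gives back the pairings of
  \<open>f\<close> and \<open>g\<close> with \<open>\<phi>\<close>, while the term with
  \<open>c\<close> vanishes by \<open>codiff_codiff\<close>.\<close>

lemma (in arrangement_hyperplane) inj_on_red_proj_dehom_space:
  "inj_on (red_proj H n) (dehom_space H n p j)"
proof (rule inj_onI)
  fix F G assume F: "F \<in> dehom_space H n p j" and G: "G \<in> dehom_space H n p j"
    and eq: "red_proj H n F = red_proj H n G"
  let ?B = "{Xs. is_flag H n p Xs \<and> \<not> H j \<preceq> last Xs}"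
  have B: "?B \<subseteq> flags H n" by (auto simp: is_flag_iff)
  then have finB: "finite ?B" using finite_flags finite_subset by blast
  obtain f g where f: "F = flag_proj H n f" "f \<in> carrier (free_module ?B)"
    and g: "G = flag_proj H n g" "g \<in> carrier (free_module ?B)"
    using F G by (auto simp: dehom_space_eq)
  then have fC: "f \<in> chains" and gC: "g \<in> chains"
    using carrier_free_module_mono[OF B] by auto
  obtain c where c: "c \<in> chains"
    "\<And>\<phi>. admissible \<phi> \<Longrightarrow> pairing \<phi> f = pairing (codiff \<phi>) c + pairing \<phi> g"
    using eq fC gC red_proj_eq_iff f g by auto
  have hom: "pairing (codiff (contract \<phi>)) a = pairing \<phi> a" if "a \<in> carrier (free_module ?B)" for a \<phi>
    unfolding pairing_def
  proof (rule sum.cong[OF refl])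
    fix Xs assume Xs: "Xs \<in> flags H n"
    have "a Xs = 0 \<or> \<not> H j \<preceq> last Xs"
      using that by (auto simp: carrier_free_module finB)
    then show "a Xs * codiff (contract \<phi>) Xs = a Xs * \<phi> Xs"
      using codiff_contract[OF Xs] by (auto simp: lat_le_def)
  qed
  have "pairing \<phi> f = pairing \<phi> g" if "admissible \<phi>" for \<phi>
  proof -
    let ?\<psi> = "codiff (contract \<phi>)"
    have adm: "admissible (contract \<phi>)" "admissible ?\<psi>"
      using that admissible_contract admissible_codiff by auto
    have "pairing (codiff ?\<psi>) c = 0"
      unfolding pairing_def using codiff_codiff[OF adm(1)] by simp
    then show ?thesis using c(2)[OF adm(2)] hom f g by simp
  qed
  then show "F = G" using fC gC f g by (simp add: flag_proj_eq_iff)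
qed

text \<open>Reduces the \<open>THE\<close> in \<open>transition\<close> to exhibiting a candidate;
  its uniqueness is the injectivity just shown.\<close>

lemma (in arrangement_hyperplane) transition_eqI:
  assumes "F \<in> dehom_space H n p i" "G \<in> dehom_space H n p j" "red_proj H n G = red_proj H n F"
  shows "transition H n p i j F = G"
  unfolding transition_def restrict_def using assms inj_onD[OF inj_on_red_proj_dehom_space]
  by (simp, intro the_equality) metis+

theorem theorem6p3:
  fixes H :: "nat \<Rightarrow> (complex ^ 'm) set"
    and n l p i j :: nat
    and Xs :: "(complex ^ 'm) set list"
  assumes "CARD('m) = l + 1"
    and "central_arrangement H n"
    and "i < j" and "j \<le> n"
    and "1 \<le> p" and "p \<le> l"
    and "is_flag H n p Xs"
    and "\<not> H i \<preceq> Xs ! p"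
  shows
    "(\<not> H j \<preceq> Xs ! p \<longrightarrow>
        transition H n p i j (flag_class H n Xs) = flag_class H n Xs) \<and>
     (H j \<preceq> Xs ! p \<and> \<not> H j \<preceq> Xs ! (p - 1) \<longrightarrow>
        transition H n p i j (flag_class H n Xs) =
          \<ominus>\<^bsub>flag_space H n\<^esub>
            (\<Oplus>\<^bsub>flag_space H n\<^esub>
               X' \<in> {X' \<in> lat H n. codim X' = p \<and> Xs ! (p - 1) \<prec> X' \<and> X' \<noteq> Xs ! p}.
               flag_class H n (take p Xs @ [X'])))"
proof -
  interpret arrangement_hyperplane H n j
    using assms by unfold_locales
  have Xs: "Xs \<in> flags H n" "length Xs = p + 1" using assms by (simp_all add: is_flag_iff)
  have fin: "finite {Xs. is_flag H n p Xs \<and> \<not> H k \<preceq> last Xs}" for k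
    by (rule finite_subset[OF _ finite_flags]) (auto simp: is_flag_iff)
  have last: "last Xs = Xs ! p" using Xs by (cases "Xs = []") (auto simp: last_conv_nth)
  have dehom: "flag_class H n Xs \<in> dehom_space H n p k" if "\<not> H k \<preceq> Xs ! p" for k
    using that assms(7) Xs unfolding dehom_space_eq flag_class_def
    by (intro imageI) (auto simp: carrier_free_module fin basis_elt_def last)
  have part_b: "transition H n p i j (flag_class H n Xs) =
      \<ominus>\<^bsub>flag_space H n\<^esub> (\<Oplus>\<^bsub>flag_space H n\<^esub>
        X' \<in> {X' \<in> lat H n. codim X' = p \<and> Xs ! (p - 1) \<prec> X' \<and> X' \<noteq> Xs ! p}.
          flag_class H n (take p Xs @ [X']))"
    if Hp: "H j \<preceq> Xs ! p" and Hp1: "\<not> H j \<preceq> Xs ! (p - 1)"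
  proof -
    let ?As = "take p Xs"
    let ?T = "{X' \<in> lat H n. codim X' = p \<and> Xs ! (p - 1) \<prec> X' \<and> X' \<noteq> Xs ! p}"
    \<comment> \<open>A chain for the right-hand side: \<open>Xs\<close> minus the differential of
      \<open>X_0 < ... < X_(p-1)\<close>, in which the term \<open>Xs\<close> itself
      cancels.\<close>
    define g where "g = - (\<Sum>X'\<in>?T. basis_elt (?As @ [X']))"
    \<comment> \<open>By \<open>1 \<le> p\<close> the truncation is nonempty; its \<open>p\<close>
      entries form a flag of degree \<open>p - 1\<close>.\<close>
    have ne: "?As \<noteq> []" using assms(5) Xs by auto
    have split: "Xs = ?As @ [Xs ! p]" using Xs(2) by (simp flip: take_Suc_conv_app_nth)
    have As: "?As \<in> flags H n" "covers (last ?As) (Xs ! p)"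
      using Xs(1) ne split flags_snoc_iff by metis+
    have last_As: "last ?As = Xs ! (p - 1)"
      using Xs ne assms(5) by (simp add: last_conv_nth)
    have cod: "codim (Xs ! (p - 1)) + 1 = p"
      using codim_last[OF As(1)] last_As assms(5) Xs by simp
    have T: "{X. ?As @ [X] \<in> flags H n} = insert (Xs ! p) ?T" "Xs ! p \<notin> ?T"
      using As ne last_As cod last_in_lat[OF As(1)]
      by (auto simp: flags_snoc_iff covers_def lat_less_def lat_le_def)
    have finT: "finite ?T" using finite_lat by simp
    have Tf: "?As @ [X'] \<in> flags H n" if "X' \<in> ?T" for X' using T that by auto
    \<comment> \<open>A member of \<open>?T\<close> inside \<open>H j\<close> would equal
      \<open>X_(p-1) \<inter> H j\<close>, which is already \<open>X_p\<close>.\<close>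
    have TH: "\<not> H j \<preceq> X'" if "X' \<in> ?T" for X'
    proof
      assume "H j \<preceq> X'"
      moreover have "covers (last ?As) X'" using Tf[OF that] ne by (simp add: flags_snoc_iff)
      ultimately have "X' = last ?As \<inter> H j" "Xs ! p = last ?As \<inter> H j"
        using As(2) Hp Hp1 last_As j by (intro covers_eq_Int_hyperplane; simp add: lat_le_def)+
      then show False using that by simp
    qed
    have sumC: "(\<Sum>X'\<in>?T. basis_elt (?As @ [X'])) \<in> chains"
      by (intro chains_sum basis_elt_chains Tf)
    then have gC: "g \<in> chains" unfolding g_def by (rule chains_uminus)
    have "\<ominus>\<^bsub>flag_space H n\<^esub> (\<Oplus>\<^bsub>flag_space H n\<^esub> X' \<in> ?T. flag_class H n (?As @ [X'])) = flag_proj H n g"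
      unfolding flag_class_def g_def flag_proj_uminus[OF sumC, symmetric]
      by (subst flag_proj_sum[OF finT basis_elt_chains[OF Tf]]) auto
    moreover have "transition H n p i j (flag_class H n Xs) = flag_proj H n g"
    proof (rule transition_eqI)
      show "flag_class H n Xs \<in> dehom_space H n p i" using dehom assms by blast
      have "g Ys = 0" if "\<not> (is_flag H n p Ys \<and> \<not> H j \<preceq> last Ys)" for Ys
      proof -
        have "Ys \<noteq> ?As @ [X']" if "X' \<in> ?T" for X'
          using Tf[OF that] TH[OF that] \<open>\<not> (is_flag H n p Ys \<and> \<not> H j \<preceq> last Ys)\<close> Xs(2)
          by (auto simp: is_flag_iff)
        then show ?thesis by (simp add: g_def sum_fun_apply basis_elt_def)
      qed
      then show "flag_proj H n g \<in> dehom_space H n p j"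
        unfolding dehom_space_eq by (intro imageI) (auto simp: carrier_free_module fin)
      \<comment> \<open>The congruence is witnessed by \<open>- basis_elt ?As\<close>: the
        extensions of \<open>?As\<close> are \<open>Xs\<close> and the flags indexed by
        \<open>?T\<close>.\<close>
      have "pairing \<phi> g = pairing (codiff \<phi>) (- basis_elt ?As) + pairing \<phi> (basis_elt Xs)" for \<phi>
      proof -
        have neg: "pairing \<phi> (- a) = - pairing \<phi> a" for \<phi> a
          by (simp add: pairing_def sum_negf)
        have "codiff \<phi> ?As = \<phi> Xs + (\<Sum>X'\<in>?T. \<phi> (?As @ [X']))"
          unfolding codiff_def T(1) using finT T(2) split by simp
        moreover have "pairing \<phi> g = - (\<Sum>X'\<in>?T. \<phi> (?As @ [X']))"
          unfolding g_def neg pairing_sum using Tf by (simp add: pairing_basis_elt)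
        ultimately show ?thesis
          using As(1) Xs(1) by (simp add: neg pairing_basis_elt)
      qed
      then show "red_proj H n (flag_proj H n g) = red_proj H n (flag_class H n Xs)"
        unfolding flag_class_def using gC Xs As
        by (subst red_proj_eq_iff) (auto intro!: bexI[of _ "- basis_elt ?As"])
    qed
    ultimately show ?thesis by simp
  qed
  \<comment> \<open>In part (a) the class of \<open>Xs\<close> lies in both spaces, so it is its own
    image.\<close>
  show ?thesis
    using part_b transition_eqI dehom assms(8) by blast
qed

end
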